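(* For odd $n\ge 3$ and every integer $r\ge 1$, there is no $r$-rainbow cycle in $\mathcal{G}_n$. For even $n\ge 2$ and every integer $r>\frac{2}{n^2}N_1(n,n/2)$, there is no $r$-rainbow cycle in $\mathcal{G}_n$.
   Context: Fix an integer $n\ge 2$ and place $2n$ points equidistantly on the unit circle. $\mathcal{M}_n$ is the set of all non-crossing straight-line perfect matchings on these $2n$ points. For $M\in\mathcal{M}_n$, two edges $e,f\in M$ span an empty quadrilateral if the convex hull of $e$ and $f$ contains no other edge of $M$; replacing $e,f$ by the other two edges of this quadrilateral yields another matching of $\mathcal{M}_n$, called a flip. $\mathcal{G}_n$ is the graph with vertex set $\mathcal{M}_n$ and an edge between any two matchings differing by a flip. A possible matching edge is a segment between two of the $2n$ points that occurs in some matching of $\mathcal{M}_n$ (there are $n^2$ of them). For an integer $r\ge1$, an $r$-rainbow cycle in $\mathcal{G}_n$ is a cycle such that every possible matching edge appears (is added to the matching) exactly $r$ times in the flips along the cycle. The generalized Narayana numbers are $N_r(n,k)=\frac{r+1}{n+1}\binom{n+1}{k}\binom{n-r-1}{k-1}$. *)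

theory Defs
  imports "HOL-Analysis.Analysis" "HOL-Library.Disjoint_Sets" "Graph_Theory.Graph_Theory"
begin

definition circle_points :: "nat \<Rightarrow> complex set" where
  "circle_points n = {cis (2 * pi * real k / real (2 * n)) | k. k < 2 * n}"

text \<open>An edge is represented by its set of two end points; the straight-line segment it stands for
  is the convex hull of that set.\<close>

definition noncrossing_matchings :: "nat \<Rightarrow> complex set set set" where
  "noncrossing_matchings n =
    {M. partition_on (circle_points n) M \<and> (\<forall>e\<in>M. card e = 2) \<and>
        (\<forall>e\<in>M. \<forall>f\<in>M. e \<noteq> f \<longrightarrow> convex hull e \<inter> convex hull f = {})}"

definition possible_edges :: "nat \<Rightarrow> complex set set" where
  "possible_edges n = \<Union> (noncrossing_matchings n)"

text \<open>Emptiness means that no other edge meets the quadrilateral. Set inclusion of another edge in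
  the quadrilateral would be the wrong notion: the points are in convex position, so another edge of
  the matching is never included in it but may cut through it.\<close>

definition empty_quadrilateral :: "complex set set \<Rightarrow> complex set \<Rightarrow> complex set \<Rightarrow> bool" where
  "empty_quadrilateral M e f \<longleftrightarrow>
    (\<forall>g \<in> M - {e, f}. convex hull g \<inter> convex hull (e \<union> f) = {})"

definition quadrilateral_sides :: "complex set \<Rightarrow> complex set \<Rightarrow> complex set set" where
  "quadrilateral_sides e f =
    {g. g \<subseteq> e \<union> f \<and> card g = 2 \<and> (convex hull g) edge_of (convex hull (e \<union> f))}"

definition flip :: "complex set set \<Rightarrow> complex set set \<Rightarrow> bool" where
  "flip M N \<longleftrightarrow> (\<exists>e\<in>M. \<exists>f\<in>M. e \<noteq> f \<and> empty_quadrilateral M e f \<and>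
     N = (M - {e, f}) \<union> (quadrilateral_sides e f - {e, f}))"

text \<open>Flips are reversible, so on non-crossing matchings \<open>flip\<close> is a symmetric relation; the
  undirected flip graph is represented by the digraph with both orientations of each edge.\<close>

definition flip_graph :: "nat \<Rightarrow> complex set set pair_pre_digraph" where
  "flip_graph n =
    \<lparr>pverts = noncrossing_matchings n,
     parcs = {(M, N). M \<in> noncrossing_matchings n \<and> N \<in> noncrossing_matchings n \<and> flip M N}\<rparr>"

text \<open>The cycle is given by its list of arcs \<open>(M, N)\<close>, each being the flip from \<open>M\<close> to \<open>N\<close>. The
  length bound excludes running back and forth along one undirected edge, which is a cycle of the
  digraph but not of the undirected graph.\<close>

definition rainbow_cycle ::
    "nat \<Rightarrow> nat \<Rightarrow> (complex set set \<times> complex set set) list \<Rightarrow> bool" where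
  "rainbow_cycle n r p \<longleftrightarrow>
    pre_digraph.cycle (with_proj (flip_graph n)) p \<and> 3 \<le> length p \<and>
    (\<forall>e \<in> possible_edges n. length (filter (\<lambda>(M, N). e \<in> N - M) p) = r)"

text \<open>Meaningful for \<open>n > r\<close> and \<open>k \<ge> 1\<close>, where the subtractions do not truncate.\<close>

definition gen_narayana :: "nat \<Rightarrow> nat \<Rightarrow> nat \<Rightarrow> real" where
  "gen_narayana r n k =
    (real r + 1) / (real n + 1) * real ((n + 1) choose k) * real ((n - r - 1) choose (k - 1))"

end

theory Submission
  imports Defs "HOL-Computational_Algebra.Formal_Power_Series"
    "HOL-Computational_Algebra.Polynomial" "HOL-Number_Theory.Cong"
begin

text \<open>
  Label the points \<open>0, \<dots>, 2 n - 1\<close>. The possible edges are the \<open>n\<^sup>2\<close> pairs of opposite parity, as each of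
  them lies in a matching by parallel chords. Give a chord the length of its shorter arc. The four
  sides of a flipped quadrilateral have total length at most \<open>2 n\<close>, with equality iff the
  quadrilateral contains the centre. In an \<open>r\<close>-rainbow cycle every edge is added and removed \<open>r\<close> times,
  so the average of this total is four times the average length of a possible edge, namely \<open>2 n\<close> for
  even \<open>n\<close> and \<open>2 n + 2 / n\<close> for odd \<open>n\<close>. The latter is impossible, and for even \<open>n\<close> all flips must be
  centred.

  Colour the regions of a matching alternately black and white. A centred flip splits the central
  region and merges two regions of the other colour into the new central region. Hence the number of
  black regions plus one if the centre is black is invariant, and every second matching of the cycle
  has a black centre and a fixed number \<open>k\<close> of black regions. If \<open>P\<^sub>n\<close> is the generating function of all
  matchings by the number of black regions, those with black centre have generating function
  \<open>(P\<^sub>n + (1 - x) P\<^bsub>n-1\<^esub>) / 2\<close>. As \<open>P\<^sub>n\<close> is a Narayana polynomial, there are \<open>N\<^sub>1(n, k) / 2\<close> of them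
  with \<open>k\<close> black regions, which is at most \<open>N\<^sub>1(n, n/2) / 2\<close>.
\<close>

subsection \<open>Narayana numbers\<close>

text \<open>Setting \<open>1/j!\<close> to \<open>0\<close> for \<open>j < 0\<close> makes \<open>rfact (j - 1) = j * rfact j\<close> hold for every integer \<open>j\<close>, so
  the identities between Narayana numbers below need no boundary cases.\<close>

definition rfact :: "int \<Rightarrow> real" where
  "rfact j = (if j < 0 then 0 else 1 / fact (nat j))"

lemma rfact_pred: "rfact (j - 1) = of_int j * rfact j"
proof (cases "j \<le> 0")
  case True
  then show ?thesis by (auto simp: rfact_def)
next
  case False
  then obtain m where "j = int (Suc m)" by (metis not_le zero_less_imp_eq_int gr0_implies_Suc)
  then show ?thesis by (simp add: rfact_def nat_add_distrib)
qed

lemma binomial_rfact: "real (m choose k) = fact m * rfact (int k) * rfact (int m - int k)"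
  by (auto simp: rfact_def binomial_fact nat_diff_distrib)

text \<open>With zero coefficients at negative indices, multiplication by the variable is a plain
  index shift, in step with the integer argument of \<open>rfact\<close>.\<close>

definition int_coeff :: "'a::zero poly \<Rightarrow> int \<Rightarrow> 'a" where
  "int_coeff p k = (if k < 0 then 0 else coeff p (nat k))"

lemma int_coeff_X_mult: "int_coeff ([:0, 1:] * p) k = int_coeff p (k - 1)"
  for p :: "'a::comm_ring_1 poly"
proof (cases "k \<le> 0")
  case True
  then show ?thesis by (auto simp: int_coeff_def)
next
  case False
  then have "nat k = Suc (nat (k - 1))" by auto
  with False show ?thesis by (simp add: int_coeff_def)
qed

lemma int_coeff_add: "int_coeff (p + q) k = int_coeff p k + int_coeff q k"
  and int_coeff_diff: "int_coeff (p' - q') k = int_coeff p' k - int_coeff q' k"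
  and int_coeff_of_nat_mult: "int_coeff (of_nat m * r) k = of_nat m * int_coeff r k"
  for p q :: "'a::comm_ring_1 poly" and p' q' r :: "'b::comm_ring_1 poly"
  by (auto simp: int_coeff_def of_nat_poly)

text \<open>For \<open>n \<ge> 1\<close> this is the classical Narayana number binom(n, k) binom(n,
  k - 1) / n; it vanishes unless 1 \<le> k \<le> n.\<close>

definition narayana :: "nat \<Rightarrow> int \<Rightarrow> real" where
  "narayana n k = fact n * fact (n - 1) * rfact k * rfact (int n - k) * rfact (k - 1) * rfact (int n - k + 1)"

text \<open>All reciprocal factorials involved are polynomial multiples of \<open>rfact k\<close>
  and \<open>rfact (int n + 3 - k)\<close>, the ones with the largest arguments, and all factorials
  are multiples of \<open>fact (n - 1)\<close>. What remains is a polynomial identity.\<close>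

lemma narayana_step:
  fixes k :: int
  assumes "n \<ge> 1"
  shows "(real n + 3) * narayana (n + 2) k =
    (2 * real n + 3) * (narayana (n + 1) k + narayana (n + 1) (k - 1)) -
    real n * (narayana n k - 2 * narayana n (k - 1) + narayana n (k - 2))"
proof -
  define a where "a = rfact k"
  define b where "b = rfact (int n + 3 - k)"
  define K where "K = real_of_int k"
  obtain m where n: "n = Suc m" using assms by (cases n) auto
  have a1: "rfact (k - 1) = K * a" using rfact_pred[of k] by (simp add: a_def K_def)
  have a2: "rfact (k - 2) = (K - 1) * (K * a)" using rfact_pred[of "k - 1"] a1 by (simp add: K_def)
  have a3: "rfact (k - 3) = (K - 2) * ((K - 1) * (K * a))" using rfact_pred[of "k - 2"] a2 by (simp add: K_def)
  have b1: "rfact (int n + 2 - k) = (real n + 3 - K) * b"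
    using rfact_pred[of "int n + 3 - k"] by (simp add: b_def K_def algebra_simps)
  have b2: "rfact (int n + 1 - k) = (real n + 2 - K) * ((real n + 3 - K) * b)"
    unfolding b1[symmetric] using rfact_pred[of "int n + 2 - k"] by (simp add: K_def algebra_simps)
  have b3: "rfact (int n - k) = (real n + 1 - K) * ((real n + 2 - K) * ((real n + 3 - K) * b))"
    unfolding b2[symmetric] using rfact_pred[of "int n + 1 - k"] by (simp add: K_def algebra_simps)
  define f where "f = (fact (n - 1) :: real)"
  have f0: "fact n = real n * f" by (simp add: n f_def)
  have f1: "fact (n + 1) = (real n + 1) * (real n * f)" using f0 by (simp add: algebra_simps)
  have f2: "fact (n + 2) = (real n + 2) * ((real n + 1) * (real n * f))"
    unfolding f1[symmetric] by (simp add: numeral_2_eq_2)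
  have int_shift: "int (n + 2) - k = int n + 2 - k" "int n + 2 - k + 1 = int n + 3 - k"
      "int (n + 1) - k = int n + 1 - k" "int n + 1 - k + 1 = int n + 2 - k"
      "int (n + 1) - (k - 1) = int n + 2 - k" "int n - (k - 1) = int n + 1 - k"
      "int n - (k - 2) = int n + 2 - k" "int n - k + 1 = int n + 1 - k"
      "k - 1 - 1 = k - 2" "k - 2 - 1 = k - 3" "n + 2 - 1 = n + 1" "n + 1 - 1 = n"
    by auto
  show ?thesis
    unfolding narayana_def int_shift f_def[symmetric] f0 f1 f2 a1 a2 a3 b1 b2 b3
      a_def[symmetric] b_def[symmetric]
    by algebra
qed

text \<open>The generating function satisfies a quadratic equation; for \<open>u\<close> the square root of its discriminant
  \<open>d\<close>, differentiating \<open>u\<^sup>2 = d\<close> gives \<open>2 d u' = d' u\<close>, whose coefficients are the recurrence.\<close>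

lemma three_term_recurrence_of_convolution:
  fixes P :: "nat \<Rightarrow> 'a::{idom, ring_char_0}"
  assumes "P 0 = 1" and "\<And>n. P (Suc n) = (\<Sum>i\<le>n. P i * P (n - i)) + (x - 1) * P n"
  shows "of_nat (n + 3) * P (n + 2) = of_nat (2 * n + 3) * ((1 + x) * P (n + 1)) - of_nat n * ((1 - x)\<^sup>2 * P n)"
proof -
  define t where "t = (fps_X :: 'a fps)"
  define F where "F = Abs_fps P"
  define c where "c = fps_const x"
  \<comment> \<open>\<open>F\<close> is a root of t F^2 + (t (c - 1) - 1) F + 1; \<open>u\<close> is
    the derivative of this quadratic at its root, hence a square root of the discriminant
    \<open>d\<close>.\<close>
  define u where "u = 2 * t * F + t * (c - 1) - 1"
  define d where "d = 1 - 2 * (1 + c) * t + (1 - c)\<^sup>2 * t\<^sup>2"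
  have F: "F = 1 + t * (F * F + (c - 1) * F)"
  proof (rule fps_ext)
    fix n
    show "fps_nth F n = fps_nth (1 + t * (F * F + (c - 1) * F)) n"
    proof (cases n)
      case 0
      then show ?thesis using assms(1) by (simp add: t_def F_def)
    next
      case (Suc m)
      have 1: "fps_nth ((c - 1) * F) m = (x - 1) * P m"
      proof -
        have "c - 1 = fps_const (x - 1)" by (simp add: c_def fps_const_sub[symmetric] del: fps_const_sub)
        then show ?thesis by (simp add: F_def)
      qed
      have 2: "fps_nth (F * F) m = (\<Sum>i\<le>m. P i * P (m - i))"
        by (simp add: F_def fps_mult_nth atMost_atLeast0)
      have "fps_nth (1 + t * (F * F + (c - 1) * F)) n = fps_nth (F * F) m + fps_nth ((c - 1) * F) m"
        unfolding t_def Suc by (simp del: fps_mult_nth)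
      then show ?thesis using 1 2 assms(2)[of m] Suc by (simp add: F_def)
    qed
  qed
  have ud: "u * u = d"
  proof -
    have "t * F * F + (t * (c - 1) - 1) * F = - 1"
      using F by (simp add: algebra_simps)
    moreover have "u * u = 4 * t * (t * F * F + (t * (c - 1) - 1) * F) + (t * (c - 1) - 1)\<^sup>2"
      by (simp add: u_def algebra_simps power2_eq_square)
    ultimately have "u * u = 4 * t * (- 1) + (t * (c - 1) - 1)\<^sup>2" by simp
    then show ?thesis by (simp add: d_def algebra_simps power2_eq_square)
  qed
  have "fps_deriv (u * u) = fps_deriv d" using ud by simp
  then have "2 * u * fps_deriv u = fps_deriv d" by (simp add: algebra_simps)
  then have "2 * d * fps_deriv u = fps_deriv d * u" using ud by (metis mult.commute mult.assoc)
  moreover have "fps_deriv d = - 2 * (1 + c) + 2 * (1 - c)\<^sup>2 * t"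
    by (simp add: d_def t_def c_def power2_eq_square algebra_simps)
  ultimately have E: "2 * d * fps_deriv u = (- 2 * (1 + c) + 2 * (1 - c)\<^sup>2 * t) * u" by simp
  define y where "y = (1 + x)"
  define z where "z = (1 - x)\<^sup>2"
  have cy: "1 + c = fps_const y" by (simp add: y_def c_def fps_const_add[symmetric] del: fps_const_add)
  have cz: "(1 - c)\<^sup>2 = fps_const z" by (simp add: z_def c_def power2_eq_square fps_const_sub[symmetric] fps_const_mult[symmetric] del: fps_const_sub fps_const_mult)
  have c1: "c - 1 = fps_const (x - 1)" by (simp add: c_def fps_const_sub[symmetric] del: fps_const_sub)
  have E': "2 * (fps_deriv u - fps_const (2 * y) * (t * fps_deriv u) + fps_const z * (t * (t * fps_deriv u)))
     = fps_const (-2 * y) * u + fps_const (2 * z) * (t * u)"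
    using E unfolding d_def cy cz
    by (simp add: algebra_simps power2_eq_square fps_numeral_fps_const
        flip: fps_const_mult fps_const_neg)
  have unth: "fps_nth u (Suc k) = 2 * P k + (if k = 0 then x - 1 else 0)" for k
    by (simp add: u_def t_def F_def c1 mult.assoc fps_numeral_fps_const numeral_fps_const)
  have "fps_nth (2 * (fps_deriv u - fps_const (2 * y) * (t * fps_deriv u) + fps_const z * (t * (t * fps_deriv u)))) (n + 2)
    = fps_nth (fps_const (-2 * y) * u + fps_const (2 * z) * (t * u)) (n + 2)"
    using E' by simp
  \<comment> \<open>Coefficient \<open>n + 2\<close> involves \<open>u\<close> at
    \<open>n + 3\<close>, \<open>n + 2\<close> and \<open>n + 1\<close>. Only index 1 carries the
    extra summand \<open>x - 1\<close>; it occurs for \<open>n = 0\<close>, where its factor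
    \<open>n\<close> cancels it.\<close>
  then have "4 * (of_nat (n + 3) * P (n + 2)) = 4 * (of_nat (2 * n + 3) * (y * P (n + 1)) - of_nat n * (z * P n))"
    by (cases "n = 0") (simp_all add: t_def numeral_fps_const unth algebra_simps)
  moreover have "(4::'a) \<noteq> 0" by simp
  ultimately show ?thesis unfolding y_def z_def using mult_left_cancel by blast
qed

text \<open>Both sides obey the same three-term recurrence, on the right by
  \<open>narayana_step\<close>. As that one starts at index 1, the values at 1 and 2 are compared
  directly.\<close>

lemma int_coeff_eq_narayana:
  fixes P :: "nat \<Rightarrow> real poly"
  assumes P: "P 0 = 1" "\<And>n. P (Suc n) = (\<Sum>i\<le>n. P i * P (n - i)) + ([:0, 1:] - 1) * P n"
    and "n \<ge> 1"
  shows "int_coeff (P n) k = narayana n k"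
  using \<open>n \<ge> 1\<close>
proof (induction n arbitrary: k rule: less_induct)
  case (less n)
  let ?x = "[:0, 1:] :: real poly"
  have rec: "of_nat (m + 3) * P (m + 2) = of_nat (2 * m + 3) * (P (m + 1) + ?x * P (m + 1))
    - of_nat m * (P m - of_nat 2 * (?x * P m) + ?x * (?x * P m))" for m
    unfolding three_term_recurrence_of_convolution[of P, OF P] by (simp only: power2_eq_square algebra_simps) simp
  have P1: "P 1 = ?x" using P(2)[of 0] P(1) by simp
  consider "n = 1" | "n = 2" | m where "n = m + 2" "m \<ge> 1"
  proof -
    assume *: "n = 1 \<Longrightarrow> thesis" "n = 2 \<Longrightarrow> thesis" "\<And>m. n = m + 2 \<Longrightarrow> 1 \<le> m \<Longrightarrow> thesis"
    show thesis
    proof (cases "n \<le> 2")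
      case True
      then show thesis using less.prems * by (metis One_nat_def Suc_leI le_neq_implies_less less_2_cases_iff not_less_eq_eq)
    next
      case False
      then show thesis using *(3)[of "n - 2"] by simp
    qed
  qed
  then show ?case
  proof cases
    case 1
    have "k \<le> 0 \<or> k = 1 \<or> k \<ge> 2" by linarith
    then show ?thesis unfolding 1 P1
      by (auto simp: int_coeff_def narayana_def rfact_def coeff_pCons split: nat.splits)
  next
    case 2
    \<comment> \<open>For \<open>m = 0\<close> the recurrence loses its last term and gives
      \<open>P 2\<close> from \<open>P 1\<close> alone.\<close>
    have "of_nat 3 * P 2 = of_nat 3 * (?x + ?x * ?x)" using rec[of 0] P1 by (simp add: numeral_2_eq_2)
    moreover have "(of_nat 3 :: real poly) \<noteq> 0" by (simp only: of_nat_eq_0_iff)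
    ultimately have "P 2 = ?x + ?x * ?x" using mult_left_cancel by blast
    then have P2: "P 2 = [:0, 1, 1:]" by simp
    have "k \<le> 0 \<or> k = 1 \<or> k = 2 \<or> k \<ge> 3" by linarith
    then show ?thesis unfolding 2 P2
      by (auto simp: int_coeff_def narayana_def rfact_def coeff_pCons fact_numeral split: nat.splits)
  next
    case (3 m)
    have "int_coeff (of_nat (m + 3) * P (m + 2)) k = (2 * real m + 3) * (narayana (m + 1) k + narayana (m + 1) (k - 1)) -
      real m * (narayana m k - 2 * narayana m (k - 1) + narayana m (k - 2))"
      unfolding rec int_coeff_add int_coeff_diff int_coeff_of_nat_mult int_coeff_X_mult
      using less.IH[of "m + 1"] less.IH[of m] 3 by simp
    also have "\<dots> = (real m + 3) * narayana (m + 2) k" using narayana_step[OF 3(2)] by simp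
    finally have "(real m + 3) * int_coeff (P (m + 2)) k = (real m + 3) * narayana (m + 2) k"
      unfolding int_coeff_of_nat_mult by simp
    then show ?thesis using 3 by simp
  qed
qed

text \<open>The right side is half of N_1(n, k). The left side is the coefficient of x^k in the
  generating function of matchings with black centre. Again everything is a polynomial multiple of a
  few reciprocal factorials.\<close>

lemma half_narayana_difference:
  assumes "n \<ge> 2" "k \<ge> 1"
  shows "(narayana n (int k) + narayana (n - 1) (int k) - narayana (n - 1) (int k - 1)) / 2 =
    1 / (real n + 1) * real ((n + 1) choose k) * real ((n - 2) choose (k - 1))"
proof -
  define a where "a = rfact (int k)"
  define b where "b = rfact (int n - int k + 1)"
  define f where "f = (fact (n - 2) :: real)"
  obtain m where n: "n = m + 2" using assms(1) by (metis le_add_diff_inverse2)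
  have a1: "rfact (int k - 1) = real k * a" using rfact_pred[of "int k"] by (simp add: a_def)
  have a2: "rfact (int k - 2) = (real k - 1) * (real k * a)"
    unfolding a1[symmetric] using rfact_pred[of "int k - 1"] by simp
  have b1: "rfact (int n - int k) = (real n - real k + 1) * b"
    using rfact_pred[of "int n - int k + 1"] by (simp add: b_def)
  have b2: "rfact (int n - int k - 1) = (real n - real k) * ((real n - real k + 1) * b)"
    unfolding b1[symmetric] using rfact_pred[of "int n - int k"] by simp
  have f1: "fact (n - 1) = (real n - 1) * f" by (simp add: n f_def)
  have f0: "fact n = real n * ((real n - 1) * f)"
    unfolding f1[symmetric] using assms(1) by (subst fact_reduce) auto
  have shift: "int (n - 1) - int k = int n - int k - 1" "int n - int k - 1 + 1 = int n - int k"
    "int (n - 1) - (int k - 1) = int n - int k" "n - 1 - 1 = n - 2" "int k - 1 - 1 = int k - 2"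
    "int (n + 1) - int k = int n - int k + 1" "int (k - 1) = int k - 1"
    "int (n - 2) - (int k - 1) = int n - int k - 1"
    using assms by auto
  have f2: "fact (n + 1) = (real n + 1) * (real n * ((real n - 1) * f))"
    unfolding f0[symmetric] by simp
  show ?thesis
    unfolding narayana_def binomial_rfact shift f2 f_def[symmetric] f1 f0 a1 a2 b1 b2
      a_def[symmetric] b_def[symmetric]
    by (simp add: divide_simps) algebra
qed

subsection \<open>Non-crossing matchings of sets of natural numbers\<close>

text \<open>A matching of a set of indices is a set of pairs, each with the smaller index first.\<close>

definition ncm :: "nat set \<Rightarrow> (nat \<times> nat) set set" where
  "ncm A = {M. (\<forall>(p, q)\<in>M. p < q \<and> p \<in> A \<and> q \<in> A) \<and>
     (\<forall>i\<in>A. \<exists>!e. e \<in> M \<and> (i = fst e \<or> i = snd e)) \<and>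
     (\<forall>(p, q)\<in>M. \<forall>(p', q')\<in>M. \<not> (p < p' \<and> p' < q \<and> q < q'))}"

lemma ncmI:
  assumes "\<And>p q. (p, q) \<in> M \<Longrightarrow> p < q \<and> p \<in> A \<and> q \<in> A"
    and "\<And>i. i \<in> A \<Longrightarrow> \<exists>e\<in>M. i = fst e \<or> i = snd e"
    and "\<And>i e e'. e \<in> M \<Longrightarrow> e' \<in> M \<Longrightarrow> i = fst e \<or> i = snd e \<Longrightarrow> i = fst e' \<or> i = snd e' \<Longrightarrow> e = e'"
    and "\<And>p q p' q'. (p, q) \<in> M \<Longrightarrow> (p', q') \<in> M \<Longrightarrow> \<not> (p < p' \<and> p' < q \<and> q < q')"
  shows "M \<in> ncm A"
  unfolding ncm_def
proof (intro CollectI conjI ballI)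
  show "\<exists>!e. e \<in> M \<and> (i = fst e \<or> i = snd e)" if "i \<in> A" for i
    using assms(2)[OF that] assms(3)[of _ _ i] by blast
qed (use assms(1,4) in auto)

lemma ncm_edge: "M \<in> ncm A \<Longrightarrow> (p, q) \<in> M \<Longrightarrow> p < q \<and> p \<in> A \<and> q \<in> A"
  by (auto simp: ncm_def)

lemma ncm_cover: "M \<in> ncm A \<Longrightarrow> i \<in> A \<Longrightarrow> \<exists>p q. (p, q) \<in> M \<and> (i = p \<or> i = q)"
  unfolding ncm_def mem_Collect_eq by (metis prod.collapse)

lemma ncm_unique:
  assumes "M \<in> ncm A" "(p, q) \<in> M" "(p', q') \<in> M" "i = p \<or> i = q" "i = p' \<or> i = q'"
  shows "p = p' \<and> q = q'"
proof -
  have "i \<in> A" using ncm_edge[OF assms(1)] assms by blast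
  then have "\<exists>!e. e \<in> M \<and> (i = fst e \<or> i = snd e)" using assms(1) by (auto simp: ncm_def)
  then have "(p, q) = (p', q')" using assms(2-) by (metis fst_conv snd_conv)
  then show ?thesis by simp
qed

lemma ncm_noncrossing:
  "M \<in> ncm A \<Longrightarrow> (p, q) \<in> M \<Longrightarrow> (p', q') \<in> M \<Longrightarrow> p < p' \<Longrightarrow> p' < q \<Longrightarrow> q' \<le> q"
  unfolding ncm_def mem_Collect_eq by (metis (no_types, lifting) case_prodD not_less)

lemma ncm_subset: "M \<in> ncm A \<Longrightarrow> M \<subseteq> A \<times> A"
  using ncm_edge by fastforce

lemma finite_ncm_edges: "finite A \<Longrightarrow> M \<in> ncm A \<Longrightarrow> finite M"
  using ncm_subset finite_subset by blast

lemma finite_ncm: "finite A \<Longrightarrow> finite (ncm A)"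
  using ncm_subset by (intro finite_subset[of "ncm A" "Pow (A \<times> A)"]) auto

lemma ncm_empty: "ncm {} = {{}}"
  by (auto simp: ncm_def)

text \<open>Every point is an end of exactly one edge. Constant weights give the parity of the point
  set, alternating signs give \<open>ncm_sum_covering\<close>.\<close>

lemma ncm_sum_endpoints:
  fixes f :: "nat \<Rightarrow> 'a::comm_monoid_add"
  assumes "M \<in> ncm A" "finite A"
  shows "(\<Sum>i\<in>A. f i) = (\<Sum>(p, q)\<in>M. f p + f q)"
proof -
  have "A = (\<Union>e\<in>M. {fst e, snd e})"
  proof
    show "A \<subseteq> (\<Union>e\<in>M. {fst e, snd e})"
      using ncm_cover[OF assms(1)] by force
    show "(\<Union>e\<in>M. {fst e, snd e}) \<subseteq> A"
      using ncm_edge[OF assms(1)] by auto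
  qed
  then have "(\<Sum>i\<in>A. f i) = (\<Sum>i\<in>(\<Union>e\<in>M. {fst e, snd e}). f i)" by simp
  also have "\<dots> = (\<Sum>e\<in>M. \<Sum>i\<in>{fst e, snd e}. f i)"
  proof (rule sum.UNION_disjoint)
    show "finite M" using finite_ncm_edges assms by blast
    show "\<forall>e\<in>M. \<forall>e'\<in>M. e \<noteq> e' \<longrightarrow> {fst e, snd e} \<inter> {fst e', snd e'} = {}"
    proof (intro ballI impI)
      fix e e' assume e: "e \<in> M" "e' \<in> M" "e \<noteq> e'"
      have "(fst e, snd e) \<in> M" "(fst e', snd e') \<in> M" using e by auto
      then show "{fst e, snd e} \<inter> {fst e', snd e'} = {}"
        using ncm_unique[OF assms(1), of "fst e" "snd e" "fst e'" "snd e'"] e(3) prod_eq_iff[of e e'] by blast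
    qed
  qed auto
  also have "\<dots> = (\<Sum>(p, q)\<in>M. f p + f q)"
  proof (rule sum.cong)
    fix e assume "e \<in> M"
    then have "fst e < snd e" using ncm_edge[OF assms(1), of "fst e" "snd e"] by auto
    then show "(\<Sum>i\<in>{fst e, snd e}. f i) = (case e of (p, q) \<Rightarrow> f p + f q)"
      by (auto simp: case_prod_beta)
  qed simp
  finally show ?thesis .
qed

lemma ncm_even_card: "M \<in> ncm A \<Longrightarrow> finite A \<Longrightarrow> even (card A)"
  using ncm_sum_endpoints[of M A "\<lambda>_. 1::nat"] by (simp add: case_prod_beta)

text \<open>The edges cut the disc into regions which are coloured alternately, black being the colour of the
  arcs from \<open>2 i\<close> to \<open>2 i + 1\<close>. The outermost region is white and the region directly below an edge
  \<open>(p, q)\<close> is black iff \<open>p\<close> is even, so \<open>even_starts\<close> counts the black regions.\<close>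

definition even_starts :: "(nat \<times> nat) set \<Rightarrow> nat" where
  "even_starts M = card {e \<in> M. even (fst e)}"

section \<open>Splitting a matching at one of its edges\<close>

definition ncm_with :: "nat set \<Rightarrow> nat \<times> nat \<Rightarrow> (nat \<times> nat) set set" where
  "ncm_with A e = {M \<in> ncm A. e \<in> M}"

definition join_at :: "nat \<times> nat \<Rightarrow> (nat \<times> nat) set \<times> (nat \<times> nat) set \<Rightarrow> (nat \<times> nat) set" where
  "join_at e XY = insert e (fst XY \<union> snd XY)"

lemma ncm_inside_or_outside:
  assumes "M \<in> ncm A" "(p, q) \<in> M" "(a, b) \<in> M" "(a, b) \<noteq> (p, q)"
  shows "(a \<in> {p<..<q} \<and> b \<in> {p<..<q}) \<or> (a \<notin> {p..q} \<and> b \<notin> {p..q})"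
proof -
  have ab: "a < b" and pq: "p < q" using assms ncm_edge by blast+
  have "a \<noteq> p" "a \<noteq> q" "b \<noteq> p" "b \<noteq> q"
    using ncm_unique[OF assms(1,2,3)] assms(4) by blast+
  moreover have "p < a \<Longrightarrow> a < q \<Longrightarrow> b \<le> q" using ncm_noncrossing[OF assms(1,2,3)] .
  moreover have "a < p \<Longrightarrow> p < b \<Longrightarrow> q \<le> b" using ncm_noncrossing[OF assms(1,3,2)] .
  ultimately show ?thesis using ab pq by (simp) linarith
qed

text \<open>No edge crosses \<open>(p, q)\<close>, so the points strictly inside and those outside
  are matched independently; restriction to the two sides is the inverse map. The outer point set
  has a gap, which is why matchings of arbitrary sets are considered.\<close>

lemma join_at_bij:
  assumes "p \<in> A" "q \<in> A" "p < q"
  shows "bij_betw (join_at (p, q)) (ncm (A \<inter> {p<..<q}) \<times> ncm (A - {p..q})) (ncm_with A (p, q))"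
proof -
  define I where "I = A \<inter> {p<..<q}"
  define U where "U = A - {p..q}"
  have A: "A = insert p (insert q (I \<union> U))" using assms by (auto simp: I_def U_def)
  show ?thesis unfolding I_def[symmetric] U_def[symmetric]
  proof (rule bij_betw_byWitness[where f' = "\<lambda>M. (M \<inter> I \<times> I, M \<inter> U \<times> U)"])
    show "\<forall>XY\<in>ncm I \<times> ncm U. (join_at (p, q) XY \<inter> I \<times> I, join_at (p, q) XY \<inter> U \<times> U) = XY"
    proof
      fix XY assume "XY \<in> ncm I \<times> ncm U"
      then obtain X Y where XY: "XY = (X, Y)" "X \<subseteq> I \<times> I" "Y \<subseteq> U \<times> U" using ncm_subset by (metis SigmaE)
      then show "(join_at (p, q) XY \<inter> I \<times> I, join_at (p, q) XY \<inter> U \<times> U) = XY"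
        using assms by (auto simp: join_at_def I_def U_def)
    qed
    show "\<forall>M\<in>ncm_with A (p, q). join_at (p, q) (M \<inter> I \<times> I, M \<inter> U \<times> U) = M"
    proof
      fix M assume "M \<in> ncm_with A (p, q)"
      then have M: "M \<in> ncm A" "(p, q) \<in> M" by (auto simp: ncm_with_def)
      have "(a, b) \<in> I \<times> I \<or> (a, b) \<in> U \<times> U" if "(a, b) \<in> M" "(a, b) \<noteq> (p, q)" for a b
        using ncm_inside_or_outside[OF M that] ncm_edge[OF M(1) that(1)] by (auto simp: I_def U_def)
      then show "join_at (p, q) (M \<inter> I \<times> I, M \<inter> U \<times> U) = M" using M(2) by (auto simp: join_at_def)
    qed
    show "join_at (p, q) ` (ncm I \<times> ncm U) \<subseteq> ncm_with A (p, q)"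
    proof (rule image_subsetI)
      fix XY assume "XY \<in> ncm I \<times> ncm U"
      then obtain X Y where XY: "XY = (X, Y)" and X: "X \<in> ncm I" and Y: "Y \<in> ncm U" by auto
      have XI: "a < b" "a \<in> A" "b \<in> A" "p < a" "a < q" "p < b" "b < q" if "(a, b) \<in> X" for a b
        using ncm_edge[OF X that] by (auto simp: I_def)
      have YU: "a < b" "a \<in> A" "b \<in> A" "a < p \<or> q < a" "b < p \<or> q < b" if "(a, b) \<in> Y" for a b
        using ncm_edge[OF Y that] by (auto simp: U_def)
      have "insert (p, q) (X \<union> Y) \<in> ncm A"
      proof (rule ncmI)
        show "a < b \<and> a \<in> A \<and> b \<in> A" if "(a, b) \<in> insert (p, q) (X \<union> Y)" for a b
          using that assms XI YU by blast
        show "\<exists>e\<in>insert (p, q) (X \<union> Y). i = fst e \<or> i = snd e" if "i \<in> A" for i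
        proof -
          consider "i = p \<or> i = q" | "i \<in> I" | "i \<in> U" using \<open>i \<in> A\<close> unfolding A by blast
          then show ?thesis
          proof cases
            case 1
            then show ?thesis by auto
          next
            case 2
            then show ?thesis using ncm_cover[OF X, of i] by force
          next
            case 3
            then show ?thesis using ncm_cover[OF Y, of i] by force
          qed
        qed
        show "e = e'" if ee: "e \<in> insert (p, q) (X \<union> Y)" "e' \<in> insert (p, q) (X \<union> Y)"
          and i: "i = fst e \<or> i = snd e" "i = fst e' \<or> i = snd e'" for i e e'
        proof -
          have where_i: "(d = (p, q) \<and> (i = p \<or> i = q)) \<or> (d \<in> X \<and> p < i \<and> i < q) \<or> (d \<in> Y \<and> (i < p \<or> q < i))"
            if "d \<in> insert (p, q) (X \<union> Y)" "i = fst d \<or> i = snd d" for d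
            using that XI[of "fst d" "snd d"] YU[of "fst d" "snd d"] by auto
          have "e = e'" if "e \<in> X \<and> e' \<in> X \<or> e \<in> Y \<and> e' \<in> Y"
            using that i ncm_unique[OF X, of "fst e" "snd e" "fst e'" "snd e'" i]
              ncm_unique[OF Y, of "fst e" "snd e" "fst e'" "snd e'" i] by (auto simp: prod_eq_iff)
          then show ?thesis
            using where_i[OF ee(1) i(1)] where_i[OF ee(2) i(2)] assms(3)
            by (elim disjE conjE) simp_all
        qed
        show "\<not> (a < a' \<and> a' < b \<and> b < b')"
          if ee: "(a, b) \<in> insert (p, q) (X \<union> Y)" "(a', b') \<in> insert (p, q) (X \<union> Y)" for a b a' b'
        proof
          assume cr: "a < a' \<and> a' < b \<and> b < b'"
          have where_ab: "(c = p \<and> d = q) \<or> ((c, d) \<in> X \<and> p < c \<and> d < q) \<or> ((c, d) \<in> Y \<and> (c < p \<or> q < c) \<and> (d < p \<or> q < d))"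
            if "(c, d) \<in> insert (p, q) (X \<union> Y)" for c d
            using that XI[of c d] YU[of c d] by auto
          have "\<not> ((a, b) \<in> X \<and> (a', b') \<in> X \<or> (a, b) \<in> Y \<and> (a', b') \<in> Y)"
            using cr ncm_noncrossing[OF X, of a b a' b'] ncm_noncrossing[OF Y, of a b a' b'] by auto
          then show False
            using where_ab[OF ee(1)] where_ab[OF ee(2)] cr assms(3)
            by (elim disjE conjE) simp_all
        qed
      qed
      then show "join_at (p, q) XY \<in> ncm_with A (p, q)" by (auto simp: join_at_def ncm_with_def XY)
    qed
    show "(\<lambda>M. (M \<inter> I \<times> I, M \<inter> U \<times> U)) ` ncm_with A (p, q) \<subseteq> ncm I \<times> ncm U"
    proof (rule image_subsetI)
      fix M assume "M \<in> ncm_with A (p, q)"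
      then have M: "M \<in> ncm A" "(p, q) \<in> M" by (auto simp: ncm_with_def)
      have IU: "(a, b) = (p, q) \<or> (a, b) \<in> I \<times> I \<or> (a, b) \<in> U \<times> U" if "(a, b) \<in> M" for a b
        using ncm_inside_or_outside[OF M that] ncm_edge[OF M(1) that(1)] by (auto simp: I_def U_def)
      have pq: "p \<notin> I" "p \<notin> U" "q \<notin> I" "q \<notin> U" and IU0: "I \<inter> U = {}" by (use assms in \<open>auto simp: I_def U_def\<close>)
      have B: "M \<inter> B \<times> B \<in> ncm B" if "B = I \<or> B = U" for B
      proof (rule ncmI)
        show "a < b \<and> a \<in> B \<and> b \<in> B" if "(a, b) \<in> M \<inter> B \<times> B" for a b
          using that ncm_edge[OF M(1)] by blast
        show "\<exists>e\<in>M \<inter> B \<times> B. i = fst e \<or> i = snd e" if "i \<in> B" for i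
        proof -
          have "i \<in> A" using \<open>i \<in> B\<close> \<open>B = I \<or> B = U\<close> A by auto
          then obtain a b where ab: "(a, b) \<in> M" "i = a \<or> i = b" using ncm_cover[OF M(1)] by blast
          then have "(a, b) \<in> B \<times> B" using IU[of a b] pq IU0 \<open>i \<in> B\<close> \<open>B = I \<or> B = U\<close> by auto
          then show ?thesis using ab by force
        qed
        show "e = e'" if "e \<in> M \<inter> B \<times> B" "e' \<in> M \<inter> B \<times> B"
          "i = fst e \<or> i = snd e" "i = fst e' \<or> i = snd e'" for i e e'
          using that ncm_unique[OF M(1), of "fst e" "snd e" "fst e'" "snd e'" i] by (auto simp: prod_eq_iff)
        show "\<not> (a < a' \<and> a' < b \<and> b < b')" if "(a, b) \<in> M \<inter> B \<times> B" "(a', b') \<in> M \<inter> B \<times> B" for a b a' b'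
          using that ncm_noncrossing[OF M(1), of a b a' b'] by auto
      qed
      then show "(M \<inter> I \<times> I, M \<inter> U \<times> U) \<in> ncm I \<times> ncm U" by blast
    qed
  qed
qed

section \<open>Generating functions by the number of black regions\<close>

definition gf :: "nat set \<Rightarrow> real poly" where
  "gf A = (\<Sum>M\<in>ncm A. monom 1 (even_starts M))"

text \<open>Even starts add up over the three parts of \<open>join_at_bij\<close>, so the generating
  functions multiply; the edge itself contributes a factor x iff it starts at an even point.\<close>

lemma sum_ncm_with:
  assumes "p \<in> A" "q \<in> A" "p < q" "finite A"
  shows "(\<Sum>M\<in>ncm_with A (p, q). monom (1::real) (even_starts M)) =
    monom 1 (if even p then 1 else 0) * gf (A \<inter> {p<..<q}) * gf (A - {p..q})"
proof -
  define I where "I = A \<inter> {p<..<q}"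
  define U where "U = A - {p..q}"
  have es: "even_starts (join_at (p, q) (X, Y)) = (if even p then 1 else 0) + even_starts X + even_starts Y"
    if "X \<in> ncm I" "Y \<in> ncm U" for X Y
  proof -
    have X: "X \<subseteq> I \<times> I" "finite X" and Y: "Y \<subseteq> U \<times> U" "finite Y"
      using ncm_subset[OF that(1)] ncm_subset[OF that(2)] finite_ncm_edges[OF _ that(1)]
        finite_ncm_edges[OF _ that(2)] assms(4) by (auto simp: I_def U_def)
    have "{e \<in> join_at (p, q) (X, Y). even (fst e)} =
       (if even p then {(p, q)} else {}) \<union> ({e \<in> X. even (fst e)} \<union> {e \<in> Y. even (fst e)})"
      by (auto simp: join_at_def)
    moreover have "card \<dots> = card (if even p then {(p, q)} else {}) + card ({e \<in> X. even (fst e)} \<union> {e \<in> Y. even (fst e)})"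
      using X Y assms(3) by (intro card_Un_disjoint) (auto simp: I_def U_def)
    moreover have "card ({e \<in> X. even (fst e)} \<union> {e \<in> Y. even (fst e)}) = even_starts X + even_starts Y"
      unfolding even_starts_def using X Y by (intro card_Un_disjoint) (fastforce simp: I_def U_def)+
    ultimately show ?thesis by (simp add: even_starts_def)
  qed
  have "(\<Sum>M\<in>ncm_with A (p, q). monom (1::real) (even_starts M)) =
    (\<Sum>XY\<in>ncm I \<times> ncm U. monom 1 (even_starts (join_at (p, q) XY)))"
    using sum.reindex_bij_betw[OF join_at_bij[OF assms(1-3)], of "\<lambda>M. monom (1::real) (even_starts M)"]
    by (simp add: I_def U_def)
  also have "\<dots> = (\<Sum>(X, Y)\<in>ncm I \<times> ncm U. monom 1 (if even p then 1 else 0) * (monom 1 (even_starts X) * monom 1 (even_starts Y)))"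
    by (intro sum.cong refl) (clarsimp simp: es mult_monom)
  also have "\<dots> = monom 1 (if even p then 1 else 0) * (gf I * gf U)"
    unfolding gf_def sum_product sum.cartesian_product
    by (simp add: sum_distrib_left case_prod_unfold del: mult_cancel_left)
  finally show ?thesis by (simp add: I_def U_def mult.assoc)
qed

text \<open>Crossings depend only on the order of the points and colours only on their parity, so
  relabellings preserving both do not affect the generating function. This allows shifting intervals
  and closing gaps.\<close>

lemma gf_image:
  assumes "strict_mono_on A f" "\<And>i. i \<in> A \<Longrightarrow> even (f i) \<longleftrightarrow> even i"
  shows "gf (f ` A) = gf A"
proof -
  have inj: "inj_on f A" using assms(1) by (rule strict_mono_on_imp_inj_on)
  have less: "f i < f j \<longleftrightarrow> i < j" if "i \<in> A" "j \<in> A" for i j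
    using that assms(1) by (metis linorder_neqE_nat order_less_asym strict_mono_onD)
  let ?F = "\<lambda>M. map_prod f f ` M"
  have "bij_betw ?F (ncm A) (ncm (f ` A))"
    unfolding bij_betw_def
  proof
    have "inj_on (map_prod f f) (A \<times> A)" using inj by (rule map_prod_inj_on) (rule inj)
    then have "inj_on ?F (Pow (A \<times> A))" by (rule inj_on_image_Pow)
    then show "inj_on ?F (ncm A)" by (rule inj_on_subset) (use ncm_subset in auto)
    show "?F ` ncm A = ncm (f ` A)"
    proof
      show "?F ` ncm A \<subseteq> ncm (f ` A)"
      proof (rule image_subsetI)
        fix M assume M: "M \<in> ncm A"
        show "?F M \<in> ncm (f ` A)"
        proof (rule ncmI)
          show "p < q \<and> p \<in> f ` A \<and> q \<in> f ` A" if "(p, q) \<in> ?F M" for p q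
            using that ncm_edge[OF M] less by auto
          show "\<exists>e\<in>?F M. i = fst e \<or> i = snd e" if "i \<in> f ` A" for i
            using that ncm_cover[OF M] by force
          show "e = e'" if ee: "e \<in> ?F M" "e' \<in> ?F M" and i: "i = fst e \<or> i = snd e" "i = fst e' \<or> i = snd e'" for i e e'
          proof -
            obtain a b a' b' where e: "e = (f a, f b)" "(a, b) \<in> M" "e' = (f a', f b')" "(a', b') \<in> M"
              using ee by (elim imageE) (auto simp: map_prod_def split: prod.splits)
            then have A: "a \<in> A" "b \<in> A" "a' \<in> A" "b' \<in> A" using ncm_edge[OF M] by blast+
            have "a = a' \<or> a = b' \<or> b = a' \<or> b = b'"
              using i e A inj_on_eq_iff[OF inj] by auto
            then have "a = a' \<and> b = b'" using ncm_unique[OF M e(2,4)] by blast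
            then show ?thesis using e by simp
          qed
          show "\<not> (p < p' \<and> p' < q \<and> q < q')" if ee: "(p, q) \<in> ?F M" "(p', q') \<in> ?F M" for p q p' q'
          proof -
            obtain a b a' b' where e: "p = f a" "q = f b" "(a, b) \<in> M" "p' = f a'" "q' = f b'" "(a', b') \<in> M"
              using ee by auto
            then have "a \<in> A" "b \<in> A" "a' \<in> A" "b' \<in> A" using ncm_edge[OF M] by blast+
            then show ?thesis using ncm_noncrossing[OF M e(3,6)] e less by auto
          qed
        qed
      qed
      show "ncm (f ` A) \<subseteq> ?F ` ncm A"
      proof
        fix N assume N: "N \<in> ncm (f ` A)"
        define M where "M = {(a, b) \<in> A \<times> A. (f a, f b) \<in> N}"
        have "N \<subseteq> f ` A \<times> f ` A" using ncm_subset[OF N] .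
        then have NM: "N = ?F M" by (auto simp: M_def image_iff)
        have "M \<in> ncm A"
        proof (rule ncmI)
          show "p < q \<and> p \<in> A \<and> q \<in> A" if "(p, q) \<in> M" for p q
            using that ncm_edge[OF N, of "f p" "f q"] less by (auto simp: M_def)
          show "\<exists>e\<in>M. i = fst e \<or> i = snd e" if "i \<in> A" for i
          proof -
            obtain p q where pq: "(p, q) \<in> N" "f i = p \<or> f i = q" using ncm_cover[OF N, of "f i"] \<open>i \<in> A\<close> by blast
            then obtain a b where ab: "a \<in> A" "b \<in> A" "p = f a" "q = f b" using ncm_edge[OF N pq(1)] by auto
            then have "(a, b) \<in> M" "i = a \<or> i = b" using pq \<open>i \<in> A\<close> inj_on_eq_iff[OF inj] by (auto simp: M_def)
            then show ?thesis by force
          qed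
          show "e = e'" if "e \<in> M" "e' \<in> M" "i = fst e \<or> i = snd e" "i = fst e' \<or> i = snd e'" for i e e'
          proof -
            obtain a b a' b' where e: "e = (a, b)" "e' = (a', b')" by (metis surj_pair)
            have m: "(f a, f b) \<in> N" "(f a', f b') \<in> N" "a \<in> A" "b \<in> A" "a' \<in> A" "b' \<in> A"
              using that e by (auto simp: M_def)
            have "f a = f a' \<and> f b = f b'" using ncm_unique[OF N m(1,2), of "f i"] that e by auto
            then show ?thesis using m e inj_onD[OF inj] by blast
          qed
          show "\<not> (p < p' \<and> p' < q \<and> q < q')" if "(p, q) \<in> M" "(p', q') \<in> M" for p q p' q'
          proof -
            have "p \<in> A" "q \<in> A" "p' \<in> A" "q' \<in> A" "(f p, f q) \<in> N" "(f p', f q') \<in> N"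
              using that by (auto simp: M_def)
            then show ?thesis
              using ncm_noncrossing[OF N, of "f p" "f q" "f p'" "f q'"] less by (metis not_less)
          qed
        qed
        then show "N \<in> ?F ` ncm A" using NM by blast
      qed
    qed
  qed
  then have "gf (f ` A) = (\<Sum>M\<in>ncm A. monom 1 (even_starts (?F M)))"
    unfolding gf_def by (rule sum.reindex_bij_betw[symmetric])
  also have "\<dots> = gf A" unfolding gf_def
  proof (rule sum.cong)
    fix M assume M: "M \<in> ncm A"
    have "even (fst (map_prod f f e)) \<longleftrightarrow> even (fst e)" if "e \<in> M" for e
      using that ncm_edge[OF M, of "fst e" "snd e"] assms(2)[of "fst e"] by simp
    then have "{e \<in> M. even (fst (map_prod f f e))} = {e \<in> M. even (fst e)}"
      by (intro Collect_cong) metis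
    then have "{e \<in> ?F M. even (fst e)} = map_prod f f ` {e \<in> M. even (fst e)}"
      using Compr_image_eq[of "map_prod f f" M "\<lambda>e. even (fst e)"] by simp
    moreover have "inj_on (map_prod f f) {e \<in> M. even (fst e)}"
      using map_prod_inj_on[OF inj inj] by (rule inj_on_subset) (use ncm_subset[OF M] in auto)
    ultimately show "monom 1 (even_starts (?F M)) = monom (1::real) (even_starts M)"
      unfolding even_starts_def by (simp add: card_image)
  qed simp
  finally show ?thesis .
qed

text \<open>The points strictly between \<open>p\<close> and \<open>q\<close> are matched among
  themselves, so their number is even.\<close>

lemma ncm_interval_odd:
  assumes "M \<in> ncm {a..<b}" "(p, q) \<in> M"
  shows "odd (q - p)"
proof -
  have pq: "p < q" "p \<in> {a..<b}" "q \<in> {a..<b}" using ncm_edge[OF assms] by auto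
  have "M \<in> ncm_with {a..<b} (p, q)" using assms by (simp add: ncm_with_def)
  then obtain X where "X \<in> ncm ({a..<b} \<inter> {p<..<q})"
    using bij_betw_imp_surj_on[OF join_at_bij[OF pq(2,3,1)]] by blast
  then have "even (card ({a..<b} \<inter> {p<..<q}))" by (rule ncm_even_card) simp
  moreover have "{a..<b} \<inter> {p<..<q} = {p<..<q}" using pq by auto
  ultimately have "even (q - Suc p)" by simp
  then show ?thesis using pq(1) by presburger
qed

text \<open>Classification by the partner of the first point \<open>s\<close>, which by parity is
  some \<open>s + 2 * i + 1\<close>.\<close>

lemma gf_first:
  "gf {s..<s + 2 * m + 2} = (\<Sum>i\<le>m. monom 1 (if even s then 1 else 0) *
     gf {s + 1..<s + 1 + 2 * i} * gf {s + 2 * i + 2..<s + 2 * m + 2})"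
proof -
  let ?A = "{s..<s + 2 * m + 2}"
  have "ncm ?A = (\<Union>i\<le>m. ncm_with ?A (s, s + 2 * i + 1))"
  proof
    show "ncm ?A \<subseteq> (\<Union>i\<le>m. ncm_with ?A (s, s + 2 * i + 1))"
    proof
      fix M assume M: "M \<in> ncm ?A"
      obtain p q where pq: "(p, q) \<in> M" "s = p \<or> s = q" using ncm_cover[OF M, of s] by auto
      have e: "p < q" "p \<in> ?A" "q \<in> ?A" using ncm_edge[OF M pq(1)] by auto
      then have p: "p = s" using pq(2) by auto
      obtain i where "q - p = 2 * i + 1" using ncm_interval_odd[OF M pq(1)] by (rule oddE)
      then have "q = s + 2 * i + 1" "i \<le> m" using e p by auto
      then show "M \<in> (\<Union>i\<le>m. ncm_with ?A (s, s + 2 * i + 1))"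
        using M pq(1) p by (auto simp: ncm_with_def)
    qed
  qed (auto simp: ncm_with_def)
  then have "gf ?A = (\<Sum>i\<le>m. \<Sum>M\<in>ncm_with ?A (s, s + 2 * i + 1). monom 1 (even_starts M))"
    unfolding gf_def
  proof (subst sum.UNION_disjoint[symmetric])
    show "\<forall>i\<in>{..m}. finite (ncm_with ?A (s, s + 2 * i + 1))"
      using finite_ncm[of ?A] by (auto simp: ncm_with_def)
    show "\<forall>i\<in>{..m}. \<forall>j\<in>{..m}. i \<noteq> j \<longrightarrow> ncm_with ?A (s, s + 2 * i + 1) \<inter> ncm_with ?A (s, s + 2 * j + 1) = {}"
    proof (intro ballI impI)
      fix i j :: nat assume "i \<noteq> j"
      then show "ncm_with ?A (s, s + 2 * i + 1) \<inter> ncm_with ?A (s, s + 2 * j + 1) = {}"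
        using ncm_unique[of _ ?A s "s + 2 * i + 1" s "s + 2 * j + 1" s] by (auto simp: ncm_with_def)
    qed
  qed auto
  also have "\<dots> = (\<Sum>i\<le>m. monom 1 (if even s then 1 else 0) *
     gf {s + 1..<s + 1 + 2 * i} * gf {s + 2 * i + 2..<s + 2 * m + 2})"
  proof (rule sum.cong)
    fix i assume i: "i \<in> {..m}"
    then have "?A \<inter> {s<..<s + 2 * i + 1} = {s + 1..<s + 1 + 2 * i}"
      "?A - {s..s + 2 * i + 1} = {s + 2 * i + 2..<s + 2 * m + 2}" by auto
    then show "(\<Sum>M\<in>ncm_with ?A (s, s + 2 * i + 1). monom 1 (even_starts M)) =
        monom 1 (if even s then 1 else 0) * gf {s + 1..<s + 1 + 2 * i} * gf {s + 2 * i + 2..<s + 2 * m + 2}"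
      using sum_ncm_with[of s ?A "s + 2 * i + 1"] i by simp
  qed simp
  finally show ?thesis .
qed

text \<open>Up to relabelling, an interval of given even size matters only through the parity of its
  first point: even for \<open>gf0\<close>, odd for \<open>gf1\<close>.\<close>

definition gf0 :: "nat \<Rightarrow> real poly" where "gf0 m = gf {..<2 * m}"
definition gf1 :: "nat \<Rightarrow> real poly" where "gf1 m = gf {1..<1 + 2 * m}"

lemma gf_shift:
  assumes "even s"
  shows "gf ((+) s ` A) = gf A"
  using assms by (intro gf_image) (auto simp: strict_mono_on_def)

lemma gf_even_start: "even s \<Longrightarrow> gf {s..<s + 2 * i} = gf0 i"
  using gf_shift[of s "{0..<2 * i}"] by (simp add: gf0_def lessThan_atLeast0 add.commute)

lemma gf_odd_start: "odd s \<Longrightarrow> gf {s..<s + 2 * i} = gf1 i"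
proof -
  assume s: "odd s"
  then have "(+) (s - 1) ` {1..<1 + 2 * i} = {s..<s + 2 * i}"
    unfolding image_add_atLeastLessThan by (cases s) auto
  then show ?thesis using gf_shift[of "s - 1" "{1..<1 + 2 * i}"] s by (simp add: gf1_def)
qed

lemma gf0_0 [simp]: "gf0 0 = 1" and gf1_0 [simp]: "gf1 0 = 1"
  by (simp_all add: gf0_def gf1_def gf_def ncm_empty even_starts_def)

lemma monom_1_1: "monom 1 1 = [:0, 1:]"
  by (simp add: monom_Suc monom_0)

lemma gf0_Suc: "gf0 (Suc m) = (\<Sum>i\<le>m. [:0, 1:] * gf1 i * gf0 (m - i))"
proof -
  have "gf0 (Suc m) = gf {0..<0 + 2 * m + 2}" using gf_even_start[of 0 "Suc m"] by (simp add: algebra_simps)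
  also have "\<dots> = (\<Sum>i\<le>m. [:0, 1:] * gf1 i * gf0 (m - i))"
    unfolding gf_first
  proof (rule sum.cong)
    fix i assume "i \<in> {..m}"
    then have "{0 + 2 * i + 2..<0 + 2 * m + 2} = {2 * i + 2..<(2 * i + 2) + 2 * (m - i)}" by auto
    then have "gf {0 + 2 * i + 2..<0 + 2 * m + 2} = gf0 (m - i)" using gf_even_start[of "2 * i + 2" "m - i"] by simp
    moreover have "gf {0 + 1..<0 + 1 + 2 * i} = gf1 i" by (simp add: gf1_def)
    ultimately show "monom 1 (if even 0 then 1 else 0) * gf {0 + 1..<0 + 1 + 2 * i} * gf {0 + 2 * i + 2..<0 + 2 * m + 2} =
         [:0, 1:] * gf1 i * gf0 (m - i)" by (simp only: monom_1_1 even_zero if_True)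
  qed simp
  finally show ?thesis .
qed

lemma gf1_Suc: "gf1 (Suc m) = (\<Sum>i\<le>m. gf0 i * gf1 (m - i))"
proof -
  have "gf1 (Suc m) = gf {1..<1 + 2 * m + 2}" by (simp add: gf1_def)
  also have "\<dots> = (\<Sum>i\<le>m. gf0 i * gf1 (m - i))"
    unfolding gf_first
  proof (rule sum.cong)
    fix i assume "i \<in> {..m}"
    then have "{1 + 2 * i + 2..<1 + 2 * m + 2} = {2 * i + 3..<(2 * i + 3) + 2 * (m - i)}" by auto
    then have "gf {1 + 2 * i + 2..<1 + 2 * m + 2} = gf1 (m - i)" using gf_odd_start[of "2 * i + 3" "m - i"] by simp
    moreover have "gf {1 + 1..<1 + 1 + 2 * i} = gf0 i" using gf_even_start[of 2 i] by (simp add: numeral_2_eq_2)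
    ultimately show "monom 1 (if even (1::nat) then 1 else 0) * gf {1 + 1..<1 + 1 + 2 * i} * gf {1 + 2 * i + 2..<1 + 2 * m + 2} =
         gf0 i * gf1 (m - i)" by simp
  qed simp
  finally show ?thesis .
qed

text \<open>Geometrically, moving point 0 to the end keeps all colours but makes a black region the
  outermost one, which is not counted; x restores it. Formally, the recursions of \<open>gf0\<close>
  and \<open>gf1\<close> are the same convolution reversed. Without points there is no such black
  region, hence the correction at \<open>i = 0\<close>.\<close>

lemma X_gf1: "[:0, 1:] * gf1 i = gf0 i + (if i = 0 then [:0, 1:] - 1 else 0)"
proof (cases i)
  case (Suc m)
  have "[:0, 1:] * gf1 (Suc m) = (\<Sum>i\<le>m. [:0, 1:] * gf0 i * gf1 (m - i))"
    by (simp only: gf1_Suc sum_distrib_left mult.assoc)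
  also have "\<dots> = (\<Sum>i\<le>m. [:0, 1:] * gf0 (m - i) * gf1 i)"
    by (subst sum.nat_diff_reindex[symmetric, of _ "Suc m", unfolded lessThan_Suc_atMost]) simp
  also have "\<dots> = gf0 (Suc m)" unfolding gf0_Suc by (intro sum.cong) (auto simp: mult_ac)
  finally show ?thesis using Suc by simp
qed simp

text \<open>Eliminating \<open>gf1\<close> leaves the hypothesis of
  \<open>three_term_recurrence_of_convolution\<close>, with the variable in the place of
  \<open>x\<close>.\<close>

lemma gf0_convolution:
  "gf0 (Suc m) = (\<Sum>i\<le>m. gf0 i * gf0 (m - i)) + ([:0, 1:] - 1) * gf0 m"
proof -
  have "gf0 (Suc m) = (\<Sum>i\<le>m. (gf0 i + (if i = 0 then [:0, 1:] - 1 else 0)) * gf0 (m - i))"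
    unfolding gf0_Suc X_gf1 ..
  also have "\<dots> = (\<Sum>i\<le>m. gf0 i * gf0 (m - i) + (if i = 0 then ([:0, 1:] - 1) * gf0 (m - i) else 0))"
    by (intro sum.cong refl) (simp only: distrib_right if_distrib[of "\<lambda>x. x * _"] mult_zero_left)
  also have "\<dots> = (\<Sum>i\<le>m. gf0 i * gf0 (m - i)) + ([:0, 1:] - 1) * gf0 m"
    by (simp only: sum.distrib sum.delta finite_atMost) simp
  finally show ?thesis .
qed

text \<open>The gap consists of \<open>2 * i + 2\<close> points, so closing it by a shift preserves
  parities.\<close>

lemma gf_outside:
  assumes "p + 2 * i + 1 < 2 * n"
  shows "gf ({..<2 * n} - {p..p + 2 * i + 1}) = gf0 (n - 1 - i)"
proof -
  let ?f = "\<lambda>j. if j < p then j else j + (2 * i + 2)"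
  have "?f ` {..<2 * (n - 1 - i)} = {..<2 * n} - {p..p + 2 * i + 1}" (is "?l = ?r")
  proof
    show "?l \<subseteq> ?r" using assms by auto
    show "?r \<subseteq> ?l"
    proof
      fix j assume j: "j \<in> ?r"
      show "j \<in> ?l"
      proof (cases "j < p")
        case True
        then show ?thesis using assms by (intro image_eqI[of _ _ j]) auto
      next
        case False
        then show ?thesis using assms j by (intro image_eqI[of _ _ "j - (2 * i + 2)"]) auto
      qed
    qed
  qed
  moreover have "gf (?f ` {..<2 * (n - 1 - i)}) = gf0 (n - 1 - i)"
    unfolding gf0_def by (intro gf_image) (auto simp: strict_mono_on_def)
  ultimately show ?thesis by simp
qed

section \<open>Matchings whose centre is black\<close>

text \<open>Edges \<open>(p, q)\<close> with \<open>q - p > n\<close> have the centre on their inner side and are nested; their start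
  points alternate in parity, beginning with an even one. Hence \<open>long_sign n M\<close> is \<open>1\<close> if the centre
  lies in a black region and \<open>0\<close> otherwise.\<close>

definition long_sign :: "nat \<Rightarrow> (nat \<times> nat) set \<Rightarrow> int" where
  "long_sign n M = (\<Sum>e\<in>{e \<in> M. n < snd e - fst e}. (-1) ^ fst e)"

lemma alternating_sum: "(\<Sum>p\<le>2 * m. (-1) ^ p) = (1 :: 'a::comm_ring_1)"
  by (induction m) auto

lemma alternating_sum_01: "(\<Sum>p<m. (-1) ^ p) \<in> {0, 1 :: int}"
proof -
  have "(\<Sum>p<m. (-1) ^ p) = (if even m then 0 else 1 :: int)" by (induction m) auto
  then show ?thesis by simp
qed

text \<open>Group the signs of the points below \<open>g\<close> by edges. The two ends of an edge
  have opposite parity, so an edge with both ends below \<open>g\<close> cancels and only edges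
  passing over the cut before \<open>g\<close> remain.\<close>

lemma ncm_sum_covering:
  assumes M: "M \<in> ncm {..<2 * n}" and "g \<le> 2 * n"
  shows "(\<Sum>e\<in>{e \<in> M. fst e < g \<and> g \<le> snd e}. (-1) ^ fst e) = (\<Sum>i<g. (-1) ^ i :: int)"
proof -
  have fin: "finite M" using finite_ncm_edges[OF _ M] by simp
  have "(\<Sum>i<g. (-1) ^ i :: int) = (\<Sum>i\<in>{..<2 * n} \<inter> {i. i < g}. (-1) ^ i)"
    using assms(2) by (intro sum.cong) auto
  also have "\<dots> = (\<Sum>i\<in>{..<2 * n}. if i < g then (-1) ^ i else 0)" by (subst sum.inter_restrict) auto
  also have "\<dots> = (\<Sum>(p, q)\<in>M. (if p < g then (-1) ^ p else 0) + (if q < g then (-1) ^ q else 0))"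
    using ncm_sum_endpoints[OF M] by simp
  also have "\<dots> = (\<Sum>e\<in>M. if fst e < g \<and> g \<le> snd e then (-1) ^ fst e else 0)"
  proof (rule sum.cong)
    fix e assume e: "e \<in> M"
    obtain p q where pq: "e = (p, q)" by fastforce
    have "p < q" using ncm_edge[OF M] e pq by blast
    moreover have "odd (q - p)" using ncm_interval_odd[of M 0 "2 * n" p q] M e pq by (simp add: lessThan_atLeast0)
    ultimately have "even q \<longleftrightarrow> odd p" by auto
    then have "(-1) ^ q = - ((-1) ^ p :: int)" by (auto simp: uminus_power_if)
    then show "(case e of (p, q) \<Rightarrow> (if p < g then (-1) ^ p else 0) + (if q < g then (-1) ^ q else 0)) =
         (if fst e < g \<and> g \<le> snd e then (-1) ^ fst e else (0::int))"
      using \<open>p < q\<close> pq by auto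
  qed simp
  also have "\<dots> = (\<Sum>e\<in>{e \<in> M. fst e < g \<and> g \<le> snd e}. (-1) ^ fst e)"
    by (rule sum.inter_filter[OF fin, symmetric])
  finally show ?thesis by simp
qed

text \<open>The long edges are exactly those passing over the cut just after the largest start
  \<open>p\<close> of a long edge: an edge over this cut is the long edge at \<open>p\<close> or
  encloses it. \<open>ncm_sum_covering\<close> then gives an alternating sum.\<close>

lemma long_sign_01:
  assumes M: "M \<in> ncm {..<2 * n}"
  shows "long_sign n M \<in> {0, 1}"
proof (cases "{e \<in> M. n < snd e - fst e} = {}")
  case True
  then show ?thesis unfolding long_sign_def by (simp only: sum.empty) simp
next
  case False
  let ?L = "{e \<in> M. n < snd e - fst e}"
  have fin: "finite ?L" using finite_ncm_edges[OF _ M] by simp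
  define p where "p = Max (fst ` ?L)"
  have "p \<in> fst ` ?L" unfolding p_def using fin False by (intro Max_in) auto
  then obtain q where pq: "(p, q) \<in> M" "n < q - p" by auto
  have max: "a \<le> p" if "(a, b) \<in> M" "n < b - a" for a b
    unfolding p_def using fin that by (intro Max_ge) force+
  have q: "q < 2 * n" using ncm_edge[OF M pq(1)] by auto
  have "?L = {e \<in> M. fst e < p + 1 \<and> p + 1 \<le> snd e}"
  proof (intro Collect_cong conj_cong refl)
    fix e assume "e \<in> M"
    then obtain a b where e: "e = (a, b)" "(a, b) \<in> M" by (metis surj_pair)
    have ab: "a < b" "b < 2 * n" using ncm_edge[OF M e(2)] by auto
    have "n < b - a" if "a \<le> p" "p < b"
    proof (cases "a = p")
      case True
      then show ?thesis using ncm_unique[OF M e(2) pq(1)] pq by auto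
    next
      case False
      then show ?thesis using ncm_noncrossing[OF M e(2) pq(1)] that pq by auto
    qed
    \<comment> \<open>A long edge ends beyond \<open>n\<close>, whereas \<open>p < n\<close> because
      \<open>q < 2 * n\<close>.\<close>
    moreover have "a \<le> p \<and> p < b" if "n < b - a"
      using max[OF e(2) that] that q pq(2) by auto
    ultimately show "n < snd e - fst e \<longleftrightarrow> fst e < p + 1 \<and> p + 1 \<le> snd e" using e by auto
  qed
  then have "long_sign n M = (\<Sum>i<p + 1. (-1) ^ i)"
    unfolding long_sign_def using ncm_sum_covering[OF M, of "p + 1"] q pq(2) by auto
  then show ?thesis using alternating_sum_01 by metis
qed

text \<open>Sum over the long edges first. The matchings through the edge from \<open>p\<close> to
  \<open>p + 2 * i + 1\<close> have a generating function that depends on \<open>i\<close> only, and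
  there are \<open>2 * (n - 1 - i) + 1\<close> positions \<open>p\<close>, an odd number, so their
  signs sum to 1. For \<open>n = 2 * h\<close> an edge is long iff \<open>i \<ge> h\<close>.\<close>

lemma sum_long_sign:
  assumes n: "n = 2 * h" and h: "h \<ge> 1"
  shows "(\<Sum>M\<in>ncm {..<2 * n}. of_int (long_sign n M) * monom 1 (even_starts M)) =
    (\<Sum>i\<in>{h..<n}. gf0 i * gf0 (n - 1 - i))"
proof -
  let ?A = "{..<2 * n}"
  let ?w = "\<lambda>M. monom (1::real) (even_starts M)"
  define S where "S = (SIGMA i:{h..<n}. {..2 * (n - 1 - i)})"
  define edge where "edge = (\<lambda>(i, p). (p :: nat, p + 2 * i + 1))"
  have inj: "inj_on edge S" by (auto simp: edge_def inj_on_def)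
  have finS: "finite S" by (simp add: S_def)
  have long: "{e \<in> M. n < snd e - fst e} = {e \<in> edge ` S. e \<in> M}" if M: "M \<in> ncm ?A" for M
  proof (intro equalityI subsetI)
    fix e assume "e \<in> {e \<in> M. n < snd e - fst e}"
    then obtain p q where e: "e = (p, q)" "(p, q) \<in> M" "n < q - p" by (cases e) auto
    have pq: "p < q" "q < 2 * n" using ncm_edge[OF M e(2)] by auto
    have "odd (q - p)" using ncm_interval_odd[of M 0 "2 * n" p q] M e by (simp add: lessThan_atLeast0)
    then obtain i where i: "q - p = 2 * i + 1" by (rule oddE)
    then have "(i, p) \<in> S" "e = edge (i, p)" using pq e n by (auto simp: S_def edge_def)
    then show "e \<in> {e \<in> edge ` S. e \<in> M}" using e(1,2) by (intro CollectI conjI image_eqI) auto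
  next
    fix e assume "e \<in> {e \<in> edge ` S. e \<in> M}"
    then show "e \<in> {e \<in> M. n < snd e - fst e}" using n by (auto simp: S_def edge_def)
  qed
  have "(\<Sum>M\<in>ncm ?A. of_int (long_sign n M) * ?w M) = (\<Sum>M\<in>ncm ?A. \<Sum>e\<in>{e \<in> edge ` S. e \<in> M}. (-1) ^ fst e * ?w M)"
    by (intro sum.cong refl) (simp add: long_sign_def long sum_distrib_right)
  also have "\<dots> = (\<Sum>e\<in>edge ` S. \<Sum>M\<in>{M \<in> ncm ?A. e \<in> M}. (-1) ^ fst e * ?w M)"
    using finite_ncm finS by (intro sum.swap_restrict) auto
  also have "\<dots> = (\<Sum>e\<in>edge ` S. (-1) ^ fst e * (\<Sum>M\<in>ncm_with ?A e. ?w M))"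
    by (simp add: ncm_with_def sum_distrib_left)
  also have "\<dots> = (\<Sum>(i, p)\<in>S. (-1) ^ p * (\<Sum>M\<in>ncm_with ?A (p, p + 2 * i + 1). ?w M))"
    by (subst sum.reindex[OF inj]) (simp add: edge_def case_prod_unfold)
  also have "\<dots> = (\<Sum>(i, p)\<in>S. (-1) ^ p * (gf0 i * gf0 (n - 1 - i)))"
  proof (rule sum.cong)
    fix ip assume "ip \<in> S"
    then obtain i p where ip: "ip = (i, p)" "h \<le> i" "i < n" "p \<le> 2 * (n - 1 - i)" by (auto simp: S_def)
    then have lt: "p + 2 * i + 1 < 2 * n" by auto
    have "?A \<inter> {p<..<p + 2 * i + 1} = {p + 1..<p + 1 + 2 * i}" using lt by auto
    \<comment> \<open>For even \<open>p\<close> the factor x turns \<open>gf1 i\<close> into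
      \<open>gf0 i\<close>, as \<open>i \<ge> h \<ge> 1\<close> excludes the exceptional case of
      \<open>X_gf1\<close>.\<close>
    moreover have "monom 1 (if even p then 1 else 0) * gf {p + 1..<p + 1 + 2 * i} = gf0 i"
    proof (cases "even p")
      case True
      then show ?thesis using gf_odd_start[of "p + 1" i] X_gf1[of i] ip h by (simp add: monom_1_1[simplified])
    next
      case False
      then show ?thesis using gf_even_start[of "p + 1" i] by simp
    qed
    ultimately have "(\<Sum>M\<in>ncm_with ?A (p, p + 2 * i + 1). ?w M) = gf0 i * gf0 (n - 1 - i)"
      using sum_ncm_with[of p ?A "p + 2 * i + 1"] gf_outside[OF lt] lt by simp
    then show "(case ip of (i, p) \<Rightarrow> (-1) ^ p * (\<Sum>M\<in>ncm_with ?A (p, p + 2 * i + 1). ?w M)) =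
      (case ip of (i, p) \<Rightarrow> (-1) ^ p * (gf0 i * gf0 (n - 1 - i)))" by (simp only: ip prod.case)
  qed simp
  also have "\<dots> = (\<Sum>i\<in>{h..<n}. \<Sum>p\<le>2 * (n - 1 - i). (-1) ^ p * (gf0 i * gf0 (n - 1 - i)))"
    unfolding S_def by (subst sum.Sigma) auto
  also have "\<dots> = (\<Sum>i\<in>{h..<n}. gf0 i * gf0 (n - 1 - i))"
    by (simp add: sum_distrib_right[symmetric] alternating_sum)
  finally show ?thesis .
qed

text \<open>The convolution has an even number \<open>n\<close> of terms, and reflecting
  \<open>i\<close> to \<open>n - 1 - i\<close> swaps its two halves.\<close>

lemma half_convolution:
  assumes n: "n = 2 * h" and h: "h \<ge> 1"
  shows "2 * (\<Sum>i\<in>{h..<n}. gf0 i * gf0 (n - 1 - i)) = gf0 n + gf0 (n - 1) - [:0, 1:] * gf0 (n - 1)"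
proof -
  have "(\<Sum>i<h. gf0 i * gf0 (n - 1 - i)) = (\<Sum>i\<in>{h..<n}. gf0 i * gf0 (n - 1 - i))"
    using n h by (intro sum.reindex_bij_witness[of _ "\<lambda>i. n - 1 - i" "\<lambda>i. n - 1 - i"]) (auto simp: mult.commute)
  moreover have "(\<Sum>i\<le>n - 1. gf0 i * gf0 (n - 1 - i)) = (\<Sum>i<h. gf0 i * gf0 (n - 1 - i)) + (\<Sum>i\<in>{h..<n}. gf0 i * gf0 (n - 1 - i))"
  proof -
    have "{..n - 1} = {..<h} \<union> {h..<n}" using n h by auto
    then show ?thesis by (simp add: sum.union_disjoint ivl_disj_int)
  qed
  moreover have "gf0 n = (\<Sum>i\<le>n - 1. gf0 i * gf0 (n - 1 - i)) + ([:0, 1:] - 1) * gf0 (n - 1)"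
    using gf0_convolution[of "n - 1"] n h by simp
  ultimately show ?thesis by (simp add: algebra_simps)
qed

text \<open>Since \<open>long_sign\<close> is 0 or 1, weighting by it selects the matchings with
  black centre, and the coefficient at \<open>k\<close> counts them. The case \<open>k = 0\<close>
  is separate because \<open>k - 1\<close> truncates.\<close>

lemma card_long_sign_1:
  assumes n: "n = 2 * h" and h: "h \<ge> 1"
  shows "real (card {M \<in> ncm {..<2 * n}. long_sign n M = 1 \<and> even_starts M = k}) =
    (if k = 0 then 0 else 1 / (real n + 1) * real ((n + 1) choose k) * real ((n - 2) choose (k - 1)))"
proof -
  let ?A = "{..<2 * n}"
  define B where "B = (\<Sum>M\<in>ncm ?A. of_int (long_sign n M) * monom (1::real) (even_starts M))"
  have fin: "finite (ncm ?A)" by (rule finite_ncm) simp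
  have "coeff B k = (\<Sum>M\<in>ncm ?A. if long_sign n M = 1 \<and> even_starts M = k then 1 else 0)"
    unfolding B_def coeff_sum
  proof (rule sum.cong)
    fix M assume "M \<in> ncm ?A"
    then have "long_sign n M \<in> {0, 1}" by (rule long_sign_01)
    then show "coeff (of_int (long_sign n M) * monom 1 (even_starts M)) k =
      (if long_sign n M = 1 \<and> even_starts M = k then 1 else (0::real))" by auto
  qed simp
  also have "\<dots> = real (card {M \<in> ncm ?A. long_sign n M = 1 \<and> even_starts M = k})"
    using fin by (simp add: sum.If_cases Int_def)
  finally have card: "real (card {M \<in> ncm ?A. long_sign n M = 1 \<and> even_starts M = k}) = int_coeff B (int k)"
    by (simp add: int_coeff_def)
  have nar: "m \<ge> 1 \<Longrightarrow> int_coeff (gf0 m) j = narayana m j" for m j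
    using int_coeff_eq_narayana[of gf0, OF gf0_0 gf0_convolution] .
  have "of_nat 2 * B = gf0 n + gf0 (n - 1) - [:0, 1:] * gf0 (n - 1)"
    using half_convolution[OF n h] sum_long_sign[OF n h] by (simp add: B_def)
  then have "int_coeff (of_nat 2 * B) (int k) = narayana n (int k) + narayana (n - 1) (int k) - narayana (n - 1) (int k - 1)"
    using n h by (simp only: int_coeff_add int_coeff_diff int_coeff_X_mult nar)
  then have "int_coeff B (int k) = (narayana n (int k) + narayana (n - 1) (int k) - narayana (n - 1) (int k - 1)) / 2"
    by (simp only: int_coeff_of_nat_mult) simp
  also have "\<dots> = (if k = 0 then 0 else 1 / (real n + 1) * real ((n + 1) choose k) * real ((n - 2) choose (k - 1)))"
  proof (cases "k = 0")
    case True
    then show ?thesis by (simp add: narayana_def rfact_def)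
  next
    case False
    then show ?thesis using half_narayana_difference[of n k] n h by (simp only: if_False)
  qed
  finally show ?thesis using card by simp
qed

text \<open>Both binomial coefficients are largest at the middle: \<open>(n + 1) div 2 = h\<close>
  and \<open>(n - 2) div 2 = h - 1\<close>.\<close>

lemma card_long_sign_1_le:
  assumes n: "n = 2 * h" and h: "h \<ge> 1"
  shows "2 * real (card {M \<in> ncm {..<2 * n}. long_sign n M = 1 \<and> even_starts M = k}) \<le>
    2 / (real n + 1) * real ((n + 1) choose h) * real ((n - 2) choose (h - 1))"
proof (cases "k = 0")
  case True
  then show ?thesis using card_long_sign_1[OF assms, of k] by simp
next
  case False
  have "(n + 1) choose k \<le> (n + 1) choose h"
    using binomial_maximum[of "n + 1" k] n by simp
  moreover have "(n - 2) choose (k - 1) \<le> (n - 2) choose (h - 1)"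
    using binomial_maximum[of "n - 2" "k - 1"] div_mult_self1_is_m[of 2 "h - 1"] n by (simp add: diff_mult_distrib2)
  ultimately have "real ((n + 1) choose k) * real ((n - 2) choose (k - 1)) \<le> real ((n + 1) choose h) * real ((n - 2) choose (h - 1))"
    by (intro mult_mono) auto
  then have "2 / (real n + 1) * (real ((n + 1) choose k) * real ((n - 2) choose (k - 1))) \<le>
     2 / (real n + 1) * (real ((n + 1) choose h) * real ((n - 2) choose (h - 1)))"
    by (intro mult_left_mono) auto
  then show ?thesis using card_long_sign_1[OF assms, of k] False by simp
qed

subsection \<open>Chords of the circle\<close>

definition pt :: "nat \<Rightarrow> nat \<Rightarrow> complex" where
  "pt n k = cis (2 * pi * real k / real (2 * n))"

lemma circle_points_pt: "circle_points n = pt n ` {..<2 * n}"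
  by (auto simp: circle_points_def pt_def)

lemma pt_eq_iff:
  assumes "i < 2 * n" "j < 2 * n"
  shows "pt n i = pt n j \<longleftrightarrow> i = j"
proof
  assume eq: "pt n i = pt n j"
  have n: "real n > 0" using assms by auto
  from eq have "sin (2 * pi * real i / real (2 * n)) = sin (2 * pi * real j / real (2 * n)) \<and>
     cos (2 * pi * real i / real (2 * n)) = cos (2 * pi * real j / real (2 * n))"
    by (simp add: pt_def complex_eq_iff)
  then obtain m :: int where "2 * pi * real i / real (2 * n) = 2 * pi * real j / real (2 * n) + 2 * pi * m"
    using sin_cos_eq_iff by blast
  then have "pi * real i = pi * (real j + 2 * real n * real_of_int m)"
    using n by (simp add: field_simps)
  then have "real i = real j + 2 * real n * real_of_int m" by simp
  then have "real_of_int (int i) = real_of_int (int j + 2 * int n * m)" by simp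
  then have m: "int i = int j + 2 * int n * m" by (simp only: of_int_eq_iff)
  then have "int i mod (2 * int n) = int j mod (2 * int n)" by simp
  then show "i = j" using assms by (simp add: mod_pos_pos_trivial)
qed simp

text \<open>Rotating by \<open>- m\<close> puts the chord from \<open>a\<close> to \<open>c\<close>
  on the vertical line at \<open>cos w\<close>. The points \<open>b\<close> and \<open>d\<close> lie
  on different sides of it, so their chord meets the line in some \<open>z\<close>; as
  \<open>z\<close> lies in the disc, its height is at most \<open>sin w\<close> and it is on the
  first chord.\<close>

lemma crossing_chords_meet:
  assumes "a < b" "b < c" "c < d" "d < a + 2 * pi"
  shows "convex hull {cis a, cis c} \<inter> convex hull {cis b, cis d} \<noteq> {}"
proof -
  define m where "m = (a + c) / 2"
  define w where "w = (c - a) / 2"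
  have w: "0 < w" "w < pi" using assms by (auto simp: w_def)
  have ac: "a = m - w" "c = m + w" by (auto simp: m_def w_def field_simps)
  define x where "x = cos (b - m)"
  define y where "y = cos (d - m)"
  have x: "cos w < x"
  proof -
    have "\<bar>b - m\<bar> < w" using assms ac by auto
    then have "cos w < cos \<bar>b - m\<bar>" using w by (intro cos_monotone_0_pi) auto
    then show ?thesis by (simp add: x_def)
  qed
  have y: "y < cos w"
  \<comment> \<open>Beyond pi the cosine increases again; the reflected angle
    \<open>2 * pi - (d - m)\<close> still exceeds \<open>w\<close> because
    \<open>d < a + 2 * pi\<close>.\<close>
  proof (cases "d - m \<le> pi")
    case True
    then show ?thesis unfolding y_def using w assms ac by (intro cos_monotone_0_pi) auto
  next
    case False
    have "cos (2 * pi - (d - m)) < cos w" using w assms ac False by (intro cos_monotone_0_pi) auto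
    then show ?thesis unfolding y_def by (metis cos_2pi_minus)
  qed
  \<comment> \<open>The solution of (1 - t) x + t y = cos w.\<close>
  define t where "t = (x - cos w) / (x - y)"
  have t: "0 \<le> t" "t \<le> 1" using x y by (auto simp: t_def divide_simps)
  define z where "z = (1 - t) *\<^sub>R cis b + t *\<^sub>R cis d"
  have z_mem: "z \<in> convex hull {cis b, cis d}"
    unfolding z_def convex_hull_2 using t by (intro CollectI exI[of _ "1 - t"] exI[of _ t]) auto
  define v where "v = z * cis (- m)"
  have v: "v = (1 - t) *\<^sub>R cis (b - m) + t *\<^sub>R cis (d - m)"
    by (simp add: v_def z_def algebra_simps cis_mult)
  have "Re v = (1 - t) * x + t * y" by (simp add: v x_def y_def)
  also have "\<dots> = x - t * (x - y)" by (simp add: algebra_simps)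
  also have "\<dots> = cos w" using x y by (simp add: t_def)
  finally have Re: "Re v = cos w" .
  have "norm v \<le> norm ((1 - t) *\<^sub>R cis (b - m)) + norm (t *\<^sub>R cis (d - m))"
    unfolding v by (rule norm_triangle_ineq)
  also have "\<dots> = 1" using t by simp
  finally have "(norm v)\<^sup>2 \<le> 1" by (simp add: power_le_one)
  then have "(Im v)\<^sup>2 \<le> 1 - (cos w)\<^sup>2" using Re by (simp add: cmod_power2)
  then have "(Im v)\<^sup>2 \<le> (sin w)\<^sup>2" by (simp add: sin_squared_eq)
  moreover have sw: "0 < sin w" using w by (rule sin_gt_zero)
  ultimately have Im: "\<bar>Im v\<bar> \<le> sin w" using abs_le_square_iff[of "Im v" "sin w"] by simp
  define s where "s = (Im v / sin w + 1) / 2"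
  have s: "0 \<le> s" "s \<le> 1" using Im sw by (auto simp: s_def divide_simps)
  have "(1 - s) *\<^sub>R cis (- w) + s *\<^sub>R cis w = v"
  proof -
    have "s * sin w * 2 = Im v + sin w" using sw by (simp add: s_def field_simps)
    then show ?thesis by (auto simp: complex_eq_iff Re algebra_simps)
  qed
  moreover have "z = v * cis m" by (simp add: v_def mult.assoc cis_mult)
  ultimately have "z = (1 - s) *\<^sub>R cis a + s *\<^sub>R cis c"
  proof -
    assume "(1 - s) *\<^sub>R cis (- w) + s *\<^sub>R cis w = v" "z = v * cis m"
    then have "z = (1 - s) *\<^sub>R (cis (- w) * cis m) + s *\<^sub>R (cis w * cis m)"
      by (metis distrib_right mult_scaleR_left)
    then show ?thesis by (simp add: cis_mult ac add.commute)
  qed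
  then have "z \<in> convex hull {cis a, cis c}"
    unfolding convex_hull_2 using s by (intro CollectI exI[of _ "1 - s"] exI[of _ s]) auto
  then show ?thesis using z_mem by blast
qed

section \<open>Encoding geometric matchings by index pairs\<close>

definition enc :: "nat \<Rightarrow> complex set set \<Rightarrow> (nat \<times> nat) set" where
  "enc n M = {(p, q). p < q \<and> q < 2 * n \<and> {pt n p, pt n q} \<in> M}"

lemma noncrossing_matchings_edge:
  assumes "M \<in> noncrossing_matchings n" "e \<in> M"
  obtains p q where "p < q" "q < 2 * n" "e = {pt n p, pt n q}"
proof -
  have "card e = 2" "e \<subseteq> circle_points n"
    using assms by (auto simp: noncrossing_matchings_def partition_on_def)
  then obtain x y where "e = {x, y}" "x \<noteq> y" by (meson card_2_iff)
  then obtain i j where "i < 2 * n" "j < 2 * n" "e = {pt n i, pt n j}" "i \<noteq> j"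
    using \<open>e \<subseteq> circle_points n\<close> unfolding circle_points_pt by auto
  then show ?thesis using that[of i j] that[of j i] by (metis insert_commute linorder_neqE_nat)
qed

lemma pt_pair_eq:
  assumes "p < q" "q < 2 * n" "p' < q'" "q' < 2 * n" "{pt n p, pt n q} = {pt n p', pt n q'}"
  shows "p = p' \<and> q = q'"
  using assms by (auto simp: doubleton_eq_iff pt_eq_iff)

text \<open>The geometry enters in the last condition: interleaved indices would give intersecting
  segments by \<open>crossing_chords_meet\<close>.\<close>

lemma enc_ncm:
  assumes M: "M \<in> noncrossing_matchings n"
  shows "enc n M \<in> ncm {..<2 * n}"
proof (rule ncmI)
  have part: "\<Union>M = circle_points n" "disjoint M"
    and hull: "\<And>e f. e \<in> M \<Longrightarrow> f \<in> M \<Longrightarrow> e \<noteq> f \<Longrightarrow> convex hull e \<inter> convex hull f = {}"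
    using M by (auto simp: noncrossing_matchings_def partition_on_def)
  show "p < q \<and> p \<in> {..<2 * n} \<and> q \<in> {..<2 * n}" if "(p, q) \<in> enc n M" for p q
    using that by (auto simp: enc_def)
  show "\<exists>e\<in>enc n M. i = fst e \<or> i = snd e" if i: "i \<in> {..<2 * n}" for i
  proof -
    have "pt n i \<in> \<Union>M" using i part(1) circle_points_pt by auto
    then obtain e where e: "e \<in> M" "pt n i \<in> e" by blast
    obtain p q where pq: "p < q" "q < 2 * n" "e = {pt n p, pt n q}"
      using noncrossing_matchings_edge[OF M e(1)] .
    then have "(p, q) \<in> enc n M" "i = p \<or> i = q" using e i by (auto simp: enc_def pt_eq_iff)
    then show ?thesis by force
  qed
  show "e = e'" if e: "e \<in> enc n M" "e' \<in> enc n M" and i: "i = fst e \<or> i = snd e" "i = fst e' \<or> i = snd e'" for i e e'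
  proof -
    obtain p q p' q' where pq: "e = (p, q)" "e' = (p', q')" by (metis surj_pair)
    have mem: "{pt n p, pt n q} \<in> M" "{pt n p', pt n q'} \<in> M" using e pq by (auto simp: enc_def)
    have "pt n i \<in> {pt n p, pt n q} \<inter> {pt n p', pt n q'}" using i pq by auto
    then have "{pt n p, pt n q} = {pt n p', pt n q'}"
      using disjointD[OF part(2) mem] by blast
    then show ?thesis using pt_pair_eq[of p q n p' q'] e pq by (auto simp: enc_def)
  qed
  show "\<not> (p < p' \<and> p' < q \<and> q < q')" if e: "(p, q) \<in> enc n M" "(p', q') \<in> enc n M" for p q p' q'
  proof
    assume cr: "p < p' \<and> p' < q \<and> q < q'"
    have q': "q' < 2 * n" using e by (auto simp: enc_def)
    define \<theta> where "\<theta> = (\<lambda>k. 2 * pi * real k / real (2 * n))"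
    have n: "real n > 0" using q' by auto
    have mono: "\<theta> i < \<theta> j" if "i < j" for i j
      unfolding \<theta>_def using that n by (simp add: divide_strict_right_mono)
    have "\<theta> q' < 2 * pi" using q' n by (simp add: \<theta>_def field_simps)
    moreover have "0 \<le> \<theta> p" by (simp add: \<theta>_def)
    ultimately have "convex hull {cis (\<theta> p), cis (\<theta> q)} \<inter> convex hull {cis (\<theta> p'), cis (\<theta> q')} \<noteq> {}"
      using cr mono by (intro crossing_chords_meet) auto
    then have "convex hull {pt n p, pt n q} \<inter> convex hull {pt n p', pt n q'} \<noteq> {}"
      by (simp add: pt_def \<theta>_def)
    moreover have "{pt n p, pt n q} \<noteq> {pt n p', pt n q'}"
      using pt_pair_eq[of p q n p' q'] cr q' by auto
    ultimately show False using hull e by (auto simp: enc_def)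
  qed
qed

lemma inj_on_enc: "inj_on (enc n) (noncrossing_matchings n)"
proof (rule inj_onI)
  have sub: "M \<subseteq> N" if M: "M \<in> noncrossing_matchings n" and "enc n M = enc n N" for M N
  proof
    fix e assume e: "e \<in> M"
    obtain p q where pq: "p < q" "q < 2 * n" "e = {pt n p, pt n q}"
      using noncrossing_matchings_edge[OF M e] .
    then have "(p, q) \<in> enc n N" using e that(2) by (auto simp: enc_def)
    then show "e \<in> N" using pq by (simp add: enc_def)
  qed
  show "M = N" if "M \<in> noncrossing_matchings n" "N \<in> noncrossing_matchings n" "enc n M = enc n N" for M N
    using sub[of M N] sub[of N M] that by auto
qed

text \<open>The chords \<open>{i, j}\<close> with \<open>i + j \<equiv> c\<close> modulo \<open>2 n\<close> are parallel, and for odd \<open>c\<close> no point is its own partner.\<close>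

definition parallel_matching :: "nat \<Rightarrow> nat \<Rightarrow> complex set set" where
  "parallel_matching n c = {{pt n i, pt n j} | i j. i < 2 * n \<and> j < 2 * n \<and> [int i + int j = int c] (mod (2 * int n))}"

lemma cong_eq_if_less:
  assumes "i < 2 * n" "j < 2 * n" "[int i = int j] (mod (2 * int n))"
  shows "i = j"
  using assms by (simp add: cong_def mod_pos_pos_trivial)

text \<open>\<open>ht\<close> is the linear projection onto the axis at angle pi c / (2 n),
  perpendicular to the chords. Two points have equal height iff they are equal or partners, so each
  chord lies in a level set of \<open>ht\<close> and different chords lie in different level
  sets.\<close>

lemma parallel_matching_noncrossing:
  assumes "odd c" and n0: "n > 0"
  shows "parallel_matching n c \<in> noncrossing_matchings n"
proof -
  define ht where "ht = (\<lambda>z. Re (z * cis (- (pi * real c / real (2 * n)))))"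
  have n: "real n > 0" using n0 by simp
  have ht_pt: "ht (pt n i) = cos (pi * (2 * real i - real c) / real (2 * n))" for i
  proof -
    have "2 * pi * real i / real (2 * n) + - (pi * real c / real (2 * n)) = pi * (2 * real i - real c) / real (2 * n)"
      using n by (simp add: field_simps)
    then show ?thesis unfolding ht_def pt_def cis_mult by simp
  qed
  have ht_iff: "ht (pt n i) = ht (pt n j) \<longleftrightarrow> i = j \<or> [int i + int j = int c] (mod (2 * int n))"
    if ij: "i < 2 * n" "j < 2 * n" for i j
  proof -
    let ?x = "pi * (2 * real i - real c) / real (2 * n)"
    let ?y = "pi * (2 * real j - real c) / real (2 * n)"
    have 1: "?x = ?y + 2 * of_int m * pi \<longleftrightarrow> int i = int j + 2 * int n * m" for m :: int
    proof -
      have "?x = ?y + 2 * of_int m * pi \<longleftrightarrow> pi * (2 * real i - real c) = pi * (2 * real j - real c + 4 * real n * of_int m)"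
        using n by (simp add: field_simps)
      also have "\<dots> \<longleftrightarrow> real_of_int (int i) = real_of_int (int j + 2 * int n * m)" by auto
      finally show ?thesis by (simp only: of_int_eq_iff)
    qed
    have 2: "?x = - ?y + 2 * of_int m * pi \<longleftrightarrow> int i + int j = int c + 2 * int n * m" for m :: int
    proof -
      have "?x = - ?y + 2 * of_int m * pi \<longleftrightarrow> pi * (2 * real i - real c) = pi * (- (2 * real j - real c) + 4 * real n * of_int m)"
        using n by (simp add: field_simps)
      also have "\<dots> \<longleftrightarrow> real_of_int (int i + int j) = real_of_int (int c + 2 * int n * m)" by auto
      finally show ?thesis by (simp only: of_int_eq_iff)
    qed
    \<comment> \<open>Equal cosines mean equal angles up to sign and full turns: one sign gives
      \<open>i = j\<close>, the other gives partners.\<close>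
    have "ht (pt n i) = ht (pt n j) \<longleftrightarrow> (\<exists>m::int. ?x = ?y + 2 * of_int m * pi \<or> ?x = - ?y + 2 * of_int m * pi)"
      unfolding ht_pt cos_eq by (metis Ints_cases Ints_of_int)
    also have "\<dots> \<longleftrightarrow> (\<exists>m::int. int i = int j + 2 * int n * m) \<or> (\<exists>m::int. int i + int j = int c + 2 * int n * m)"
      unfolding 1 2 by blast
    also have "(\<exists>m::int. int i = int j + 2 * int n * m) \<longleftrightarrow> [int j = int i] (mod (2 * int n))"
      by (simp add: cong_iff_lin)
    also have "\<dots> \<longleftrightarrow> i = j" using cong_eq_if_less ij by auto
    also have "(\<exists>m::int. int i + int j = int c + 2 * int n * m) \<longleftrightarrow> [int c = int i + int j] (mod (2 * int n))"
      by (simp add: cong_iff_lin)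
    finally show ?thesis by (simp add: cong_sym_eq)
  qed
  have partner: "i' = j" if "i < 2 * n" "j < 2 * n" "i' < 2 * n"
    "[int i + int j = int c] (mod (2 * int n))" "[int i + int i' = int c] (mod (2 * int n))" for i j i'
  proof -
    have "[int i + int i' = int i + int j] (mod (2 * int n))" using that(4,5) cong_trans cong_sym by blast
    then have "[int i' = int j] (mod (2 * int n))" by (simp add: cong_add_lcancel)
    then show ?thesis using cong_eq_if_less that by blast
  qed
  have ht_hull: "ht z = ht a" if z: "z \<in> convex hull {a, b}" and ab: "ht a = ht b" for z a b
  proof -
    obtain u v where uv: "z = u *\<^sub>R a + v *\<^sub>R b" "u + v = 1" using z by (auto simp: convex_hull_2)
    have "ht z = u * ht a + v * ht b" unfolding uv ht_def by (simp add: algebra_simps)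
    also have "\<dots> = (u + v) * ht a" using ab by (simp add: algebra_simps)
    finally show ?thesis using uv by simp
  qed
  have hull: "convex hull e \<inter> convex hull f = {}" if ef: "e \<in> parallel_matching n c" "f \<in> parallel_matching n c" "e \<noteq> f" for e f
  proof (rule ccontr)
    assume "convex hull e \<inter> convex hull f \<noteq> {}"
    then obtain z where z: "z \<in> convex hull e" "z \<in> convex hull f" by blast
    obtain i j where e: "e = {pt n i, pt n j}" "i < 2 * n" "j < 2 * n" "[int i + int j = int c] (mod (2 * int n))"
      using ef(1) by (auto simp: parallel_matching_def)
    obtain i' j' where f: "f = {pt n i', pt n j'}" "i' < 2 * n" "j' < 2 * n" "[int i' + int j' = int c] (mod (2 * int n))"
      using ef(2) by (auto simp: parallel_matching_def)
    have "ht z = ht (pt n i)" using z(1) e ht_iff[of i j] ht_hull by auto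
    moreover have "ht z = ht (pt n i')" using z(2) f ht_iff[of i' j'] ht_hull by auto
    ultimately have "i = i' \<or> [int i + int i' = int c] (mod (2 * int n))" using ht_iff[of i i'] e f by simp
    then show False
    proof
      assume "i = i'"
      then have "j' = j" using partner[of i j j'] e f by simp
      then show False using \<open>i = i'\<close> e f ef by simp
    next
      assume "[int i + int i' = int c] (mod (2 * int n))"
      then have "i' = j" using partner[of i j i'] e f by simp
      then have "j' = i" using partner[of j i j'] e f by (simp add: add.commute)
      then show False using \<open>i' = j\<close> e f ef by auto
    qed
  qed
  have sub: "e \<subseteq> convex hull e" for e :: "complex set" by (rule hull_subset)
  have "disjoint (parallel_matching n c)" unfolding disjoint_def using hull sub by blast
  moreover have "\<Union>(parallel_matching n c) = circle_points n"
  proof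
    show "\<Union>(parallel_matching n c) \<subseteq> circle_points n" by (auto simp: parallel_matching_def circle_points_pt)
    show "circle_points n \<subseteq> \<Union>(parallel_matching n c)"
    proof
      fix z assume "z \<in> circle_points n"
      then obtain i where i: "z = pt n i" "i < 2 * n" by (auto simp: circle_points_pt)
      define j where "j = nat ((int c - int i) mod (2 * int n))"
      have j: "int j = (int c - int i) mod (2 * int n)" "j < 2 * n"
        using n0 by (auto simp: j_def nat_less_iff)
      have "[int i + int j = int i + (int c - int i)] (mod (2 * int n))"
        unfolding j(1) by (intro cong_add cong_refl) (simp add: cong_def)
      then have "{pt n i, pt n j} \<in> parallel_matching n c" using i(2) j(2)
        unfolding parallel_matching_def by (intro CollectI exI[of _ i] exI[of _ j]) simp
      then show "z \<in> \<Union>(parallel_matching n c)" using i by blast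
    qed
  qed
  moreover have "card e = 2" if mem: "e \<in> parallel_matching n c" for e
  proof -
    obtain i j where e: "e = {pt n i, pt n j}" "i < 2 * n" "j < 2 * n" "[int i + int j = int c] (mod (2 * int n))"
      using mem by (auto simp: parallel_matching_def)
    have "i \<noteq> j"
    proof
      assume "i = j"
      then have "[2 * int i = int c] (mod 2)" using e(4) cong_modulus_mult[of _ _ 2] by force
      then show False using assms(1) by (simp add: cong_def) presburger
    qed
    then show ?thesis using e by (auto simp: pt_eq_iff card_2_iff)
  qed
  moreover have "{} \<notin> parallel_matching n c" by (auto simp: parallel_matching_def)
  ultimately show ?thesis using hull by (auto simp: noncrossing_matchings_def partition_on_def)
qed

text \<open>This makes the rainbow condition, stated for \<open>possible_edges\<close>, available
  for every pair of opposite parity.\<close>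

lemma odd_pair_possible:
  assumes "p < q" "q < 2 * n" "odd (q - p)"
  shows "{pt n p, pt n q} \<in> possible_edges n"
proof -
  have "odd (p + q)" using assms by presburger
  then have "parallel_matching n (p + q) \<in> noncrossing_matchings n"
    using assms by (intro parallel_matching_noncrossing) auto
  moreover have "{pt n p, pt n q} \<in> parallel_matching n (p + q)"
    using assms unfolding parallel_matching_def by fastforce
  ultimately show ?thesis unfolding possible_edges_def by blast
qed

subsection \<open>Flips and rainbow cycles\<close>

text \<open>A flip in terms of indices: one pair of opposite sides of a quadrilateral replaces the
  other, in either direction. Disjointness from \<open>R\<close> makes the two set differences
  exactly these pairs.\<close>

definition exchange :: "nat \<Rightarrow> (nat \<times> nat) set \<Rightarrow> (nat \<times> nat) set \<Rightarrow> bool" where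
  "exchange n m m' \<longleftrightarrow> (\<exists>w x y z R. w < x \<and> x < y \<and> y < z \<and> z < 2 * n \<and>
     R \<inter> {(w, x), (y, z), (w, z), (x, y)} = {} \<and>
     (m = R \<union> {(w, x), (y, z)} \<and> m' = R \<union> {(w, z), (x, y)} \<or>
      m = R \<union> {(w, z), (x, y)} \<and> m' = R \<union> {(w, x), (y, z)}))"

text \<open>The four freed points are rematched among themselves without the old edges. Of the two
  remaining pairings one crosses, so the new edges are forced without determining the sides of the
  convex hull.\<close>

lemma exchange_of_partners:
  assumes m: "m \<in> ncm {..<2 * n}" and m': "m' \<in> ncm {..<2 * n}"
    and e: "(a, b) \<in> m" "(c, d) \<in> m" "a < c"
    and keep: "m - {(a, b), (c, d)} \<subseteq> m'"
    and new: "\<And>p q. (p, q) \<in> m' \<Longrightarrow> (p, q) \<noteq> (a, b) \<and> (p, q) \<noteq> (c, d) \<and> ((p, q) \<in> m \<or> {p, q} \<subseteq> {a, b, c, d})"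
  shows "exchange n m m'"
proof -
  have ab: "a < b" "b < 2 * n" and cd: "c < d" "d < 2 * n" using ncm_edge[OF m] e by auto
  have ne: "b \<noteq> c" "b \<noteq> d" using ncm_unique[OF m e(1,2)] e(3) by blast+
  have partner: "\<exists>j. ((i, j) \<in> m' \<or> (j, i) \<in> m') \<and> j \<in> {a, b, c, d} \<and> j \<noteq> i \<and> (i, j) \<notin> {(a, b), (c, d)} \<and> (j, i) \<notin> {(a, b), (c, d)}"
    if i: "i \<in> {a, b, c, d}" for i
  proof -
    have "i < 2 * n" using i ab cd by auto
    then obtain p q where pq: "(p, q) \<in> m'" "i = p \<or> i = q" using ncm_cover[OF m', of i] by auto
    have n: "(p, q) \<noteq> (a, b)" "(p, q) \<noteq> (c, d)" "(p, q) \<in> m \<or> {p, q} \<subseteq> {a, b, c, d}" using new[OF pq(1)] by auto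
    have "(p, q) \<notin> m"
    proof
      assume "(p, q) \<in> m"
      then show False
        using i pq(2) n(1,2) ncm_unique[OF m \<open>(p, q) \<in> m\<close> e(1), of i] ncm_unique[OF m \<open>(p, q) \<in> m\<close> e(2), of i] by auto
    qed
    then have "{p, q} \<subseteq> {a, b, c, d}" using n by blast
    moreover have "p < q" using ncm_edge[OF m' pq(1)] by auto
    ultimately have pq': "p \<in> {a, b, c, d}" "q \<in> {a, b, c, d}" "p \<noteq> q" "(q, p) \<notin> {(a, b), (c, d)}"
      using ab(1) cd(1) by auto
    show ?thesis
    proof (cases "i = p")
      case True
      then show ?thesis using pq(1) pq' n(1,2) by (intro exI[of _ q]) simp
    next
      case False
      then show ?thesis using pq pq' n(1,2) by (intro exI[of _ p]) simp
    qed
  qed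
  have lt: "p < q" if "(p, q) \<in> m'" for p q using ncm_edge[OF m' that] by auto
  have uniq: "p = p' \<and> q = q'" if "(p, q) \<in> m'" "(p', q') \<in> m'" "{p, q} \<inter> {p', q'} \<noteq> {}" for p q p' q'
    using that ncm_unique[OF m' that(1,2)] by blast
  have nc: "q' \<le> q" if "(p, q) \<in> m'" "(p', q') \<in> m'" "p < p'" "p' < q" for p q p' q'
    using ncm_noncrossing[OF m' that] .
  have new_pairs: "m' = (m - {(a, b), (c, d)}) \<union> {g, h}"
    if gh: "g \<in> m'" "h \<in> m'" "{fst g, snd g, fst h, snd h} = {a, b, c, d}" for g h
  proof
    show "m' \<subseteq> (m - {(a, b), (c, d)}) \<union> {g, h}"
    proof
      fix e' assume e': "e' \<in> m'"
      obtain p q where pq: "e' = (p, q)" by fastforce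
      show "e' \<in> (m - {(a, b), (c, d)}) \<union> {g, h}"
      proof (cases "(p, q) \<in> m")
        case True
        then show ?thesis using new[of p q] e' pq by auto
      next
        case False
        then have "p \<in> {fst g, snd g, fst h, snd h}" using new[of p q] e' pq gh(3) by blast
        then have "(p, q) = g \<or> (p, q) = h"
          using uniq[of p q "fst g" "snd g"] uniq[of p q "fst h" "snd h"] e' pq gh(1,2) by (auto simp: prod_eq_iff)
        then show ?thesis using pq by blast
      qed
    qed
    show "(m - {(a, b), (c, d)}) \<union> {g, h} \<subseteq> m'" using keep gh by blast
  qed
  have not_m: "(p, q) \<notin> m" if "{p, q} \<subseteq> {a, b, c, d}" "(p, q) \<noteq> (a, b)" "(p, q) \<noteq> (c, d)" for p q
  proof
    assume pq: "(p, q) \<in> m"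
    show False
      using that ncm_unique[OF m pq e(1), of p] ncm_unique[OF m pq e(2), of p] by auto
  qed
  have m_split: "m = (m - {(a, b), (c, d)}) \<union> {(a, b), (c, d)}" using e by blast
  consider "a < b" "b < c" "c < d" | "a < c" "c < d" "d < b"
    using ncm_noncrossing[OF m e(1,2,3)] ab cd e(3) ne by linarith
  then show ?thesis
  proof cases
    case 1
    obtain j where j: "(a, j) \<in> m' \<or> (j, a) \<in> m'" "j \<in> {c, d}" using partner[of a] 1 by auto
    obtain k where k: "(b, k) \<in> m' \<or> (k, b) \<in> m'" "k \<in> {c, d}" using partner[of b] 1 by auto
    have "(a, j) \<in> m'" "(b, k) \<in> m'" using j k lt 1 by fastforce+
    moreover have "j \<noteq> k" using uniq[of a j b k] calculation 1 by auto
    \<comment> \<open>The edges \<open>(a, c)\<close> and \<open>(b, d)\<close> would cross.\<close>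
    moreover have "j \<noteq> c" using nc[of a j b k] calculation j k 1 by auto
    ultimately have "(a, d) \<in> m'" "(b, c) \<in> m'" using j k by auto
    then have "m' = (m - {(a, b), (c, d)}) \<union> {(a, d), (b, c)}" by (intro new_pairs) auto
    moreover have "(m - {(a, b), (c, d)}) \<inter> {(a, b), (c, d), (a, d), (b, c)} = {}"
      using not_m[of a d] not_m[of b c] 1 by auto
    ultimately show ?thesis unfolding exchange_def
      using 1 cd m_split by (intro exI[of _ a] exI[of _ b] exI[of _ c] exI[of _ d] exI[of _ "m - {(a, b), (c, d)}"]) simp
  next
    case 2
    obtain j where j: "(a, j) \<in> m' \<or> (j, a) \<in> m'" "j \<in> {c, d}" using partner[of a] 2 by auto
    obtain k where k: "(b, k) \<in> m' \<or> (k, b) \<in> m'" "k \<in> {c, d}" using partner[of b] 2 by auto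
    have "(a, j) \<in> m'" "(k, b) \<in> m'" using j k lt 2 by fastforce+
    moreover have "j \<noteq> k" using uniq[of a j k b] calculation 2 by auto
    \<comment> \<open>Here \<open>(a, d)\<close> and \<open>(c, b)\<close> would cross.\<close>
    moreover have "j \<noteq> d" using nc[of a j k b] calculation j k 2 by auto
    ultimately have "(a, c) \<in> m'" "(d, b) \<in> m'" using j k by auto
    then have "m' = (m - {(a, b), (c, d)}) \<union> {(a, c), (d, b)}" by (intro new_pairs) auto
    moreover have "(m - {(a, b), (c, d)}) \<inter> {(a, c), (d, b), (a, b), (c, d)} = {}"
      using not_m[of a c] not_m[of d b] 2 by auto
    ultimately show ?thesis unfolding exchange_def
      using 2 ab m_split by (intro exI[of _ a] exI[of _ c] exI[of _ d] exI[of _ b] exI[of _ "m - {(a, b), (c, d)}"]) simp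
  qed
qed

text \<open>Added segments join ends of \<open>e\<close> and \<open>f\<close>. As \<open>N\<close>
  is again a non-crossing matching, \<open>exchange_of_partners\<close> identifies them; exchanging
  \<open>e\<close> and \<open>f\<close> if necessary gives \<open>a < c\<close>.\<close>

lemma flip_exchange:
  assumes M: "M \<in> noncrossing_matchings n" and N: "N \<in> noncrossing_matchings n" and "flip M N"
  shows "exchange n (enc n M) (enc n N)"
proof -
  have main: "exchange n (enc n M) (enc n N)"
    if ef: "(a, b) \<in> enc n M" "(c, d) \<in> enc n M" "a < c" "e = {pt n a, pt n b}" "f = {pt n c, pt n d}"
      and NM: "N = (M - {e, f}) \<union> (quadrilateral_sides e f - {e, f})" for a b c d e f
  proof (rule exchange_of_partners[OF enc_ncm[OF M] enc_ncm[OF N] ef(1-3)])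
    have ab: "a < b" "b < 2 * n" and cd: "c < d" "d < 2 * n" using ef(1,2) by (auto simp: enc_def)
    show "enc n M - {(a, b), (c, d)} \<subseteq> enc n N"
    proof
      fix g assume g: "g \<in> enc n M - {(a, b), (c, d)}"
      obtain p q where pq: "g = (p, q)" by fastforce
      then have "{pt n p, pt n q} \<noteq> e" "{pt n p, pt n q} \<noteq> f"
        using g ab cd pt_pair_eq[of p q n a b] pt_pair_eq[of p q n c d] unfolding ef(4,5) by (auto simp: enc_def)
      then show "g \<in> enc n N" using g pq unfolding NM by (auto simp: enc_def)
    qed
    fix p q assume pq: "(p, q) \<in> enc n N"
    then have lt: "p < q" "q < 2 * n" and mem: "{pt n p, pt n q} \<in> N" by (auto simp: enc_def)
    have "{pt n p, pt n q} \<noteq> e" "{pt n p, pt n q} \<noteq> f" using mem unfolding NM by auto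
    then have "(p, q) \<noteq> (a, b)" "(p, q) \<noteq> (c, d)" unfolding ef(4,5) by auto
    moreover have "(p, q) \<in> enc n M \<or> {p, q} \<subseteq> {a, b, c, d}"
    proof (cases "{pt n p, pt n q} \<in> M")
      case True
      then show ?thesis using lt by (simp add: enc_def)
    next
      case False
      then have "{pt n p, pt n q} \<subseteq> {pt n a, pt n b, pt n c, pt n d}"
        using mem unfolding NM quadrilateral_sides_def ef(4,5) by auto
      then show ?thesis using lt ab cd by (auto simp: pt_eq_iff)
    qed
    ultimately show "(p, q) \<noteq> (a, b) \<and> (p, q) \<noteq> (c, d) \<and> ((p, q) \<in> enc n M \<or> {p, q} \<subseteq> {a, b, c, d})" by blast
  qed
  obtain e f where ef: "e \<in> M" "f \<in> M" "e \<noteq> f" "N = (M - {e, f}) \<union> (quadrilateral_sides e f - {e, f})"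
    using \<open>flip M N\<close> by (auto simp: flip_def)
  obtain a b where ab: "a < b" "b < 2 * n" "e = {pt n a, pt n b}" using noncrossing_matchings_edge[OF M ef(1)] .
  obtain c d where cd: "c < d" "d < 2 * n" "f = {pt n c, pt n d}" using noncrossing_matchings_edge[OF M ef(2)] .
  have enc: "(a, b) \<in> enc n M" "(c, d) \<in> enc n M" using ab cd ef by (auto simp: enc_def)
  have "a \<noteq> c" using ncm_unique[OF enc_ncm[OF M] enc, of a] ab(3) cd(3) ef(3) by auto
  then consider "a < c" | "c < a" by linarith
  then show ?thesis
  proof cases
    case 1
    then show ?thesis using main[OF enc 1 ab(3) cd(3) ef(4)] by simp
  next
    case 2
    have "N = (M - {f, e}) \<union> (quadrilateral_sides f e - {f, e})"
      using ef(4) by (simp add: quadrilateral_sides_def Un_commute insert_commute)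
    then show ?thesis using main[OF enc(2,1) 2 cd(3) ab(3)] by simp
  qed
qed

section \<open>Walks, and the total length of the possible edges\<close>

fun closes :: "'a \<Rightarrow> ('a \<times> 'a) list \<Rightarrow> 'a \<Rightarrow> bool" where
  "closes u [] v = (u = v)"
| "closes u (a # ps) v = (fst a = u \<and> closes (snd a) ps v)"

lemma closes_telescope:
  "closes u ps v \<Longrightarrow> (\<Sum>a\<leftarrow>ps. \<phi> (snd a) - \<phi> (fst a)) = \<phi> v - (\<phi> u :: int)"
  by (induction ps arbitrary: u) auto

lemma closes_invariant:
  "closes u ps v \<Longrightarrow> \<forall>a\<in>set ps. \<phi> (snd a) = \<phi> (fst a) \<Longrightarrow> a \<in> set ps \<Longrightarrow> \<phi> (snd a) = \<phi> u"
  by (induction ps arbitrary: u) auto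

text \<open>The codes of the possible edges, by \<open>ncm_interval_odd\<close> and
  \<open>odd_pair_possible\<close>.\<close>

definition odd_pairs :: "nat \<Rightarrow> (nat \<times> nat) set" where
  "odd_pairs n = {(p, q). p < q \<and> q < 2 * n \<and> odd (q - p)}"

lemma finite_odd_pairs: "finite (odd_pairs n)"
  by (rule finite_subset[of _ "{..<2 * n} \<times> {..<2 * n}"]) (auto simp: odd_pairs_def)

lemma sum_odd_pairs:
  fixes f :: "nat \<Rightarrow> int"
  shows "(\<Sum>e\<in>odd_pairs n. f (snd e - fst e)) = (\<Sum>i<n. (2 * int n - 2 * int i - 1) * f (2 * i + 1))"
proof -
  define S where "S = (SIGMA i:{..<n}. {..2 * (n - 1 - i)})"
  define edge where "edge = (\<lambda>(i, p). (p :: nat, p + 2 * i + 1))"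
  have inj: "inj_on edge S" by (auto simp: edge_def inj_on_def)
  have "odd_pairs n = edge ` S"
  proof
    show "odd_pairs n \<subseteq> edge ` S"
    proof
      fix e assume "e \<in> odd_pairs n"
      then obtain p q where e: "e = (p, q)" "p < q" "q < 2 * n" "odd (q - p)" by (auto simp: odd_pairs_def)
      obtain i where i: "q - p = 2 * i + 1" using e(4) by (rule oddE)
      have "(i, p) \<in> S" "e = edge (i, p)" using i e by (auto simp: S_def edge_def)
      then show "e \<in> edge ` S" by simp
    qed
    show "edge ` S \<subseteq> odd_pairs n" by (auto simp: S_def edge_def odd_pairs_def)
  qed
  then have "(\<Sum>e\<in>odd_pairs n. f (snd e - fst e)) = (\<Sum>(i, p)\<in>S. f (2 * i + 1))"
    by (simp add: sum.reindex[OF inj]) (auto simp: edge_def case_prod_unfold intro!: sum.cong)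
  also have "\<dots> = (\<Sum>i<n. \<Sum>p\<le>2 * (n - 1 - i). f (2 * i + 1))"
    unfolding S_def by (subst sum.Sigma) auto
  also have "\<dots> = (\<Sum>i<n. (2 * int n - 2 * int i - 1) * f (2 * i + 1))"
    by (intro sum.cong refl) (auto simp: of_nat_diff algebra_simps)
  finally show ?thesis .
qed

definition chord_len :: "nat \<Rightarrow> nat \<times> nat \<Rightarrow> int" where
  "chord_len n e = min (int (snd e - fst e)) (2 * int n - int (snd e - fst e))"

lemma card_odd_pairs: "int (card (odd_pairs n)) = int n ^ 2"
proof -
  have "int (card (odd_pairs n)) = (\<Sum>i<n. (2 * int n - 2 * int i - 1))"
    using sum_odd_pairs[of "\<lambda>_. 1" n] by simp
  also have "\<dots> = (\<Sum>i<n. 2 * int i + 1)"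
    by (subst sum.nat_diff_reindex[symmetric]) (auto intro!: sum.cong simp: of_nat_diff algebra_simps)
  also have "\<dots> = int n ^ 2" by (induction n) (auto simp: power2_eq_square algebra_simps)
  finally show ?thesis .
qed

text \<open>Induction in steps of two: the first and last summands are 1, and each inner one exceeds
  the corresponding summand for \<open>n - 2\<close> by 2.\<close>

lemma sum_min_odd: "2 * (\<Sum>i<n. min (2 * int i + 1) (2 * int n - 2 * int i - 1)) = int n ^ 2 + (if odd n then 1 else 0)"
proof (induction n rule: less_induct)
  case (less n)
  show ?case
  proof (cases "n \<le> 1")
    case True
    then have "n = 0 \<or> n = 1" by auto
    then show ?thesis by auto
  next
    case False
    then obtain m where n: "n = Suc (Suc m)" by (metis One_nat_def Suc_le_mono le0 not0_implies_Suc nat.distinct(1) le_SucE)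
    let ?f = "\<lambda>i. min (2 * int i + 1) (2 * int n - 2 * int i - 1)"
    have "(\<Sum>i<n. ?f i) = ?f 0 + (\<Sum>i<m. ?f (Suc i)) + ?f (Suc m)"
      unfolding n by (subst sum.lessThan_Suc, subst sum.lessThan_Suc_shift, rule refl)
    also have "(\<Sum>i<m. ?f (Suc i)) = (\<Sum>i<m. min (2 * int i + 1) (2 * int m - 2 * int i - 1) + 2)"
      by (intro sum.cong refl) (auto simp: n min_def)
    also have "\<dots> = (\<Sum>i<m. min (2 * int i + 1) (2 * int m - 2 * int i - 1)) + 2 * int m"
      by (simp add: sum.distrib)
    finally have "2 * (\<Sum>i<n. ?f i) = int m ^ 2 + (if odd m then 1 else 0) + 4 * int m + 2 * (?f 0 + ?f (Suc m))"
      using less.IH[of m] n by (simp add: algebra_simps)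
    then show ?thesis by (simp add: n power2_eq_square algebra_simps)
  qed
qed

text \<open>Reflecting \<open>i\<close> to \<open>n - 1 - i\<close> preserves the length and turns
  the multiplicity \<open>2 n - 2 i - 1\<close> into \<open>2 i + 1\<close>; the two versions add up
  to the constant weight \<open>2 n\<close>.\<close>

lemma sum_chord_len:
  "2 * (\<Sum>e\<in>odd_pairs n. chord_len n e) = int n * (int n ^ 2 + (if odd n then 1 else 0))"
proof -
  let ?f = "\<lambda>i. min (2 * int i + 1) (2 * int n - 2 * int i - 1)"
  have S: "(\<Sum>e\<in>odd_pairs n. chord_len n e) = (\<Sum>i<n. (2 * int n - 2 * int i - 1) * ?f i)"
    using sum_odd_pairs[of "\<lambda>k. min (int k) (2 * int n - int k)" n] by (simp add: chord_len_def algebra_simps)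
  also have "\<dots> = (\<Sum>i<n. (2 * int i + 1) * ?f i)"
    by (subst sum.nat_diff_reindex[symmetric]) (auto intro!: sum.cong simp: of_nat_diff algebra_simps min.commute)
  finally have "2 * (\<Sum>e\<in>odd_pairs n. chord_len n e) = (\<Sum>i<n. (2 * int n - 2 * int i - 1) * ?f i + (2 * int i + 1) * ?f i)"
    using S by (simp only: sum.distrib)
  also have "\<dots> = (\<Sum>i<n. 2 * int n * ?f i)" by (intro sum.cong refl) (simp add: algebra_simps)
  also have "\<dots> = int n * (2 * (\<Sum>i<n. ?f i))" by (simp add: sum_distrib_left mult_ac)
  finally show ?thesis unfolding sum_min_odd .
qed

text \<open>Double counting of incidences between list entries \<open>a\<close> and elements of
  \<open>S a\<close>.\<close>

lemma sum_list_sum_filter: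
  fixes f :: "'e \<Rightarrow> int"
  assumes "finite E" "\<And>a. a \<in> set ps \<Longrightarrow> S a \<subseteq> E"
  shows "(\<Sum>a\<leftarrow>ps. \<Sum>e\<in>S a. f e) = (\<Sum>e\<in>E. int (length (filter (\<lambda>a. e \<in> S a) ps)) * f e)"
  using assms(2)
proof (induction ps)
  case (Cons a ps)
  have "(\<Sum>e\<in>S a. f e) = (\<Sum>e\<in>E. if e \<in> S a then f e else 0)"
    using assms(1) Cons.prems[of a] by (simp add: sum.inter_restrict[symmetric] Int_absorb1)
  then have "(\<Sum>a\<leftarrow>a # ps. \<Sum>e\<in>S a. f e) = (\<Sum>e\<in>E. (if e \<in> S a then f e else 0) + int (length (filter (\<lambda>a. e \<in> S a) ps)) * f e)"
    using Cons by (simp add: sum.distrib)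
  also have "\<dots> = (\<Sum>e\<in>E. int (length (filter (\<lambda>a. e \<in> S a) (a # ps))) * f e)"
    by (intro sum.cong refl) (auto simp: algebra_simps)
  finally show ?case .
qed simp

section \<open>Effect of a single flip on lengths and colours\<close>

lemma exchangeE:
  assumes "exchange n m m'"
  obtains w x y z where "w < x" "x < y" "y < z" "z < 2 * n"
    "m' - m = {(w, z), (x, y)} \<and> m - m' = {(w, x), (y, z)} \<or> m' - m = {(w, x), (y, z)} \<and> m - m' = {(w, z), (x, y)}"
proof -
  obtain w x y z R where *: "w < x" "x < y" "y < z" "z < 2 * n" "R \<inter> {(w, x), (y, z), (w, z), (x, y)} = {}"
     "m = R \<union> {(w, x), (y, z)} \<and> m' = R \<union> {(w, z), (x, y)} \<or> m = R \<union> {(w, z), (x, y)} \<and> m' = R \<union> {(w, x), (y, z)}"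
    using assms unfolding exchange_def by blast
  have "{(w, x), (y, z)} \<inter> {(w, z), (x, y)} = {}" using * by auto
  moreover have "(R \<union> A) - (R \<union> B) = A" if "R \<inter> A = {}" "A \<inter> B = {}" for A B :: "(nat \<times> nat) set" using that by blast
  moreover have "R \<inter> {(w, x), (y, z)} = {}" "R \<inter> {(w, z), (x, y)} = {}" using *(5) by auto
  ultimately have "m' - m = {(w, z), (x, y)} \<and> m - m' = {(w, x), (y, z)} \<or> m' - m = {(w, x), (y, z)} \<and> m - m' = {(w, z), (x, y)}"
    using *(6) by (metis Int_commute)
  then show ?thesis by (rule that[OF *(1-4)])
qed

lemma sum_diff_sets:
  fixes f :: "'e \<Rightarrow> 'a::ab_group_add"
  assumes "finite A" "finite B"
  shows "sum f B - sum f A = sum f (B - A) - sum f (A - B)"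
proof -
  have "sum f B = sum f (B \<inter> A) + sum f (B - A)" "sum f A = sum f (B \<inter> A) + sum f (A - B)"
    using sum.Int_Diff[OF assms(2), of f A] sum.Int_Diff[OF assms(1), of f B] by (simp_all add: Int_commute)
  then show ?thesis by simp
qed

lemma exchange_card: "exchange n m m' \<Longrightarrow> card (m' - m) = 2"
  by (elim exchangeE disjE conjE) simp_all

text \<open>Each side is at most as long as the arc it cuts off on the side away from the
  quadrilateral, and these four arcs make up the circle.\<close>

lemma exchange_chord_len:
  assumes "exchange n m m'"
  shows "(\<Sum>e\<in>m' - m. chord_len n e) + (\<Sum>e\<in>m - m'. chord_len n e) \<le> 2 * int n"
proof -
  obtain w x y z where *: "w < x" "x < y" "y < z" "z < 2 * n"
    "m' - m = {(w, z), (x, y)} \<and> m - m' = {(w, x), (y, z)} \<or> m' - m = {(w, x), (y, z)} \<and> m - m' = {(w, z), (x, y)}"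
    using exchangeE[OF assms] .
  have "(\<Sum>e\<in>m' - m. chord_len n e) + (\<Sum>e\<in>m - m'. chord_len n e) =
    chord_len n (w, x) + chord_len n (y, z) + chord_len n (w, z) + chord_len n (x, y)"
    using *(5) *(1-4) by (elim disjE conjE) simp_all
  also have "\<dots> \<le> int (x - w) + int (z - y) + (2 * int n - int (z - w)) + int (y - x)"
    unfolding chord_len_def by (intro add_mono) simp_all
  also have "\<dots> = 2 * int n" using * by simp
  finally show ?thesis .
qed

lemma even_starts_sum: "finite m \<Longrightarrow> int (even_starts m) = (\<Sum>e\<in>m. if even (fst e) then 1 else 0)"
  by (simp add: even_starts_def sum.If_cases Int_def)

lemma long_sign_sum: "finite m \<Longrightarrow> long_sign n m = (\<Sum>e\<in>m. if n < snd e - fst e then (-1) ^ fst e else 0)"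
  unfolding long_sign_def by (rule sum.inter_filter)

text \<open>Tightness makes \<open>(w, z)\<close> the only long one of the four sides, so the flip
  changes \<open>long_sign\<close> by one, with sign \<open>(-1) ^ w\<close> if
  \<open>(w, z)\<close> is added. As \<open>x\<close> and \<open>w\<close> differ in parity while
  \<open>y\<close> and \<open>w\<close> agree, the number of even starts changes by the opposite
  amount.\<close>

lemma exchange_centred:
  assumes ex: "exchange n m m'" and n: "even n" and m: "m \<in> ncm {..<2 * n}" and m': "m' \<in> ncm {..<2 * n}"
    and tight: "(\<Sum>e\<in>m' - m. chord_len n e) + (\<Sum>e\<in>m - m'. chord_len n e) = 2 * int n"
  shows "long_sign n m' + int (even_starts m') = long_sign n m + int (even_starts m)"
    and "long_sign n m + long_sign n m' = 1"
proof -
  obtain w x y z where *: "w < x" "x < y" "y < z" "z < 2 * n"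
    and mm: "m' - m = {(w, z), (x, y)} \<and> m - m' = {(w, x), (y, z)} \<or> m' - m = {(w, x), (y, z)} \<and> m - m' = {(w, z), (x, y)}"
    using exchangeE[OF ex] .
  have "(\<Sum>e\<in>m' - m. chord_len n e) + (\<Sum>e\<in>m - m'. chord_len n e) =
    chord_len n (w, x) + chord_len n (y, z) + chord_len n (w, z) + chord_len n (x, y)"
    using mm * by (elim disjE conjE) simp_all
  then have le: "x - w \<le> n" "z - y \<le> n" "n \<le> z - w" "y - x \<le> n"
    using tight * unfolding chord_len_def by (auto simp: min_def split: if_splits)
  have "(w, x) \<in> m \<union> m'" "(y, z) \<in> m \<union> m'" "(w, z) \<in> m \<union> m'" "(x, y) \<in> m \<union> m'" using mm by blast+
  then have odd: "odd (x - w)" "odd (z - y)" "odd (z - w)" "odd (y - x)"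
    using ncm_interval_odd[of m 0 "2 * n"] ncm_interval_odd[of m' 0 "2 * n"] m m' by (auto simp: lessThan_atLeast0)
  have strict: "\<not> n < x - w" "\<not> n < z - y" "n < z - w" "\<not> n < y - x"
  proof -
    \<comment> \<open>Edge lengths are odd and \<open>n\<close> is even, which excludes a diameter
      and makes the comparison strict.\<close>
    have "n \<noteq> z - w" using odd(3) n by metis
    then show "\<not> n < x - w" "\<not> n < z - y" "n < z - w" "\<not> n < y - x" using le by linarith+
  qed
  have par: "even x \<longleftrightarrow> odd w" "even y \<longleftrightarrow> even w" using odd(1,4) * by auto
  have fin: "finite m" "finite m'" using finite_ncm_edges m m' by blast+
  define g where "g = (\<lambda>e. if n < snd e - fst e then (-1) ^ fst e else (0 :: int))"
  define k where "k = (\<lambda>e :: nat \<times> nat. if even (fst e) then 1 else (0 :: int))"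
  have g: "long_sign n m' - long_sign n m = sum g (m' - m) - sum g (m - m')"
    using sum_diff_sets[OF fin] long_sign_sum fin by (simp add: g_def)
  have k: "int (even_starts m') - int (even_starts m) = sum k (m' - m) - sum k (m - m')"
    using sum_diff_sets[OF fin] even_starts_sum fin by (simp add: k_def)
  have gs: "sum g {(w, z), (x, y)} = (-1) ^ w" "sum g {(w, x), (y, z)} = 0"
    using * strict by (auto simp: g_def)
  have ks: "sum k {(w, z), (x, y)} - sum k {(w, x), (y, z)} = - ((-1) ^ w)"
    using * par by (auto simp: k_def)
  show "long_sign n m' + int (even_starts m') = long_sign n m + int (even_starts m)"
    using mm g k gs ks by (elim disjE conjE) simp_all
  have "\<bar>long_sign n m' - long_sign n m\<bar> = 1" using mm g gs by (elim disjE conjE) simp_all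
  then show "long_sign n m + long_sign n m' = 1"
    using long_sign_01[OF m] long_sign_01[OF m'] by auto
qed

section \<open>Counting along a rainbow cycle\<close>

locale exchange_cycle =
  fixes n r :: nat and u :: "(nat \<times> nat) set" and ps :: "((nat \<times> nat) set \<times> (nat \<times> nat) set) list"
  assumes n_pos: "n > 0"
    and closed: "closes u ps u"
    and matchings: "\<And>a. a \<in> set ps \<Longrightarrow> fst a \<in> ncm {..<2 * n} \<and> snd a \<in> ncm {..<2 * n}"
    and exchanges: "\<And>a. a \<in> set ps \<Longrightarrow> exchange n (fst a) (snd a)"
    and distinct_heads: "distinct (map snd ps)"
    and rainbow: "\<And>e. e \<in> odd_pairs n \<Longrightarrow> length (filter (\<lambda>a. e \<in> snd a - fst a) ps) = r"
begin

lemma finite_ends: "a \<in> set ps \<Longrightarrow> finite (fst a) \<and> finite (snd a)"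
  using matchings finite_ncm_edges by blast

lemma sum_added: "(\<Sum>a\<leftarrow>ps. \<Sum>e\<in>snd a - fst a. f e) = int r * (\<Sum>e\<in>odd_pairs n. f e)"
  for f :: "nat \<times> nat \<Rightarrow> int"
proof -
  have "snd a - fst a \<subseteq> odd_pairs n" if "a \<in> set ps" for a
  proof
    fix e assume "e \<in> snd a - fst a"
    moreover obtain p q where "e = (p, q)" by fastforce
    moreover have "snd a \<in> ncm {0..<2 * n}" using matchings[OF that] by (simp add: lessThan_atLeast0)
    ultimately show "e \<in> odd_pairs n"
      using ncm_edge[of "snd a" "{0..<2 * n}" p q] ncm_interval_odd[of "snd a" 0 "2 * n" p q] by (auto simp: odd_pairs_def)
  qed
  then have "(\<Sum>a\<leftarrow>ps. \<Sum>e\<in>snd a - fst a. f e) =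
      (\<Sum>e\<in>odd_pairs n. int (length (filter (\<lambda>a. e \<in> snd a - fst a) ps)) * f e)"
    by (intro sum_list_sum_filter finite_odd_pairs)
  also have "\<dots> = (\<Sum>e\<in>odd_pairs n. int r * f e)" using rainbow by (intro sum.cong refl) simp
  finally show ?thesis by (simp add: sum_distrib_left)
qed

text \<open>Each flip adds two edges, and each of the n^2 possible edges is added \<open>r\<close>
  times.\<close>

lemma two_length: "2 * int (length ps) = int r * int n ^ 2"
proof -
  have "(\<Sum>a\<leftarrow>ps. \<Sum>e\<in>snd a - fst a. 1) = (\<Sum>a\<leftarrow>ps. 2 :: int)"
    using exchange_card[OF exchanges] by (intro arg_cong[of _ _ sum_list] map_cong refl) simp
  then show ?thesis using sum_added[of "\<lambda>_. 1"] card_odd_pairs[of n] by (simp add: sum_list_triv)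
qed

text \<open>Vanishes iff the quadrilateral of the flip contains the centre.\<close>

definition slack :: "(nat \<times> nat) set \<times> (nat \<times> nat) set \<Rightarrow> int" where
  "slack a = 2 * int n - ((\<Sum>e\<in>snd a - fst a. chord_len n e) + (\<Sum>e\<in>fst a - snd a. chord_len n e))"

lemma slack_nonneg: "a \<in> set ps \<Longrightarrow> slack a \<ge> 0"
  using exchange_chord_len[OF exchanges] by (simp add: slack_def)

text \<open>The removed length of a flip is its added length minus the change of total length. The
  changes telescope to zero along the cycle, leaving twice the added length, known from
  \<open>sum_added\<close> and \<open>sum_chord_len\<close>.\<close>

lemma sum_slack: "(\<Sum>a\<leftarrow>ps. slack a) = - (int r * int n * (if odd n then 1 else 0))"
proof -
  let ?\<phi> = "\<lambda>m. \<Sum>e\<in>m. chord_len n e"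
  have "(\<Sum>a\<leftarrow>ps. slack a) = (\<Sum>a\<leftarrow>ps. 2 * int n + (?\<phi> (snd a) - ?\<phi> (fst a)) - 2 * ?\<phi> (snd a - fst a))"
  proof (intro arg_cong[of _ _ sum_list] map_cong refl)
    fix a assume "a \<in> set ps"
    then show "slack a = 2 * int n + (?\<phi> (snd a) - ?\<phi> (fst a)) - 2 * ?\<phi> (snd a - fst a)"
      using sum_diff_sets[of "fst a" "snd a" "chord_len n"] finite_ends by (simp add: slack_def)
  qed
  also have "\<dots> = 2 * int n * int (length ps) + (\<Sum>a\<leftarrow>ps. ?\<phi> (snd a) - ?\<phi> (fst a)) - 2 * (\<Sum>a\<leftarrow>ps. ?\<phi> (snd a - fst a))"
    by (simp add: sum_list_addf sum_list_subtractf sum_list_triv sum_list_const_mult)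
  also have "\<dots> = int n * (int r * int n ^ 2) - int r * (int n * (int n ^ 2 + (if odd n then 1 else 0)))"
    using closes_telescope[OF closed, of ?\<phi>] two_length sum_added[of "chord_len n"] sum_chord_len[of n]
    by (simp add: algebra_simps)
  finally show ?thesis by (simp add: algebra_simps)
qed

lemma even_or_zero: "even n \<or> r = 0"
proof -
  have "(\<Sum>a\<leftarrow>ps. slack a) \<ge> 0" using slack_nonneg by (intro sum_list_nonneg) auto
  then have "int r * int n * (if odd n then 1 else 0) \<le> 0" using sum_slack by linarith
  then show ?thesis using n_pos by (auto simp: mult_le_0_iff split: if_splits)
qed

lemma slack_zero: "even n \<Longrightarrow> a \<in> set ps \<Longrightarrow> slack a = 0"
proof -
  assume "even n" "a \<in> set ps"
  then have "(\<Sum>a\<leftarrow>ps. slack a) = 0" using sum_slack by simp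
  then have "\<forall>s\<in>set (map slack ps). s = 0" using slack_nonneg by (subst (asm) sum_list_nonneg_eq_0_iff) auto
  then show ?thesis using \<open>a \<in> set ps\<close> by simp
qed

text \<open>All flips are centred, so the centre changes colour at each step and half of the heads
  have a black centre. By the invariant these share one number of black regions, and they are
  distinct.\<close>

lemma length_le:
  assumes "even n"
  shows "\<exists>k. length ps \<le> 2 * card {M \<in> ncm {..<2 * n}. long_sign n M = 1 \<and> even_starts M = k}"
proof -
  let ?D = "long_sign n"
  have centred: "?D (snd a) + int (even_starts (snd a)) = ?D (fst a) + int (even_starts (fst a))"
      "?D (fst a) + ?D (snd a) = 1" if "a \<in> set ps" for a
    using exchange_centred[OF exchanges[OF that] assms] matchings[OF that] slack_zero[OF assms that]
    by (simp_all add: slack_def)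
  define c where "c = ?D u + int (even_starts u)"
  have c: "?D (snd a) + int (even_starts (snd a)) = c" if "a \<in> set ps" for a
    using closes_invariant[OF closed, of "\<lambda>m. ?D m + int (even_starts m)"] centred(1) that by (simp add: c_def)
  \<comment> \<open>The invariant is \<open>c\<close>, and a black centre accounts for 1 of
    it.\<close>
  let ?B = "{M \<in> ncm {..<2 * n}. ?D M = 1 \<and> even_starts M = nat (c - 1)}"
  have "(\<Sum>a\<leftarrow>ps. ?D (fst a) + ?D (snd a)) = int (length ps)"
  proof -
    have "(\<Sum>a\<leftarrow>ps. ?D (fst a) + ?D (snd a)) = (\<Sum>a\<leftarrow>ps. 1)"
      using centred(2) by (intro arg_cong[of _ _ sum_list] map_cong refl)
    then show ?thesis by (simp add: sum_list_triv)
  qed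
  moreover have "(\<Sum>a\<leftarrow>ps. ?D (snd a) - ?D (fst a)) = 0" using closes_telescope[OF closed, of ?D] by simp
  \<comment> \<open>Adding the two sums cancels the tails and leaves twice the sum over the
    heads.\<close>
  ultimately have "int (length ps) = 2 * (\<Sum>a\<leftarrow>ps. ?D (snd a))"
    by (simp add: sum_list_addf sum_list_subtractf)
  also have "(\<Sum>a\<leftarrow>ps. ?D (snd a)) = sum ?D (snd ` set ps)"
    using sum_list_distinct_conv_sum_set[OF distinct_heads, of ?D] by (simp add: comp_def)
  also have "\<dots> = (\<Sum>M\<in>snd ` set ps. if ?D M = 1 then 1 else 0)"
    using matchings long_sign_01 by (intro sum.cong refl) force
  also have "\<dots> = int (card {M \<in> snd ` set ps. ?D M = 1})" by (simp add: sum.If_cases Int_def)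
  also have "\<dots> \<le> int (card ?B)"
  proof -
    have "{M \<in> snd ` set ps. ?D M = 1} \<subseteq> ?B" using matchings c by force
    then show ?thesis using finite_ncm[of "{..<2 * n}"] by (simp add: card_mono)
  qed
  finally show ?thesis by (intro exI[of _ "nat (c - 1)"]) simp
qed

lemma r_bound:
  assumes "even n"
  shows "real r \<le> 2 / (real n)\<^sup>2 * gen_narayana 1 n (n div 2)"
proof -
  obtain h where h: "n = 2 * h" using assms by (elim evenE)
  have h1: "h \<ge> 1" using h n_pos by simp
  obtain k where "length ps \<le> 2 * card {M \<in> ncm {..<2 * n}. long_sign n M = 1 \<and> even_starts M = k}"
    using length_le[OF assms] by blast
  then have "real (length ps) \<le> 2 * real (card {M \<in> ncm {..<2 * n}. long_sign n M = 1 \<and> even_starts M = k})"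
    by linarith
  also have "\<dots> \<le> 2 / (real n + 1) * real ((n + 1) choose h) * real ((n - 2) choose (h - 1))"
    by (rule card_long_sign_1_le[OF h h1])
  also have "\<dots> = gen_narayana 1 n (n div 2)"
  proof -
    have "n - 1 - 1 = n - 2" "n div 2 = h" using h by auto
    then show ?thesis unfolding gen_narayana_def by simp
  qed
  finally have "real (length ps) \<le> gen_narayana 1 n (n div 2)" .
  moreover have "2 * real (length ps) = real r * real n ^ 2"
    using arg_cong[OF two_length, of real_of_int] by simp
  ultimately show ?thesis using n_pos by (simp add: field_simps)
qed

end

text \<open>Transport along \<open>enc\<close>, whose injectivity keeps the vertices of the cycle
  distinct.\<close>

lemma rainbow_cycle_exchange_cycle:
  assumes "rainbow_cycle n r p" "n > 0"
  shows "\<exists>u ps. exchange_cycle n r u ps"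
proof -
  let ?G = "with_proj (flip_graph n)"
  let ?enc = "\<lambda>a. (enc n (fst a), enc n (snd a))"
  obtain u where u: "pre_digraph.awalk ?G u p u" "distinct (tl (pre_digraph.awalk_verts ?G u p))" "p \<noteq> []"
    and r: "\<And>e. e \<in> possible_edges n \<Longrightarrow> length (filter (\<lambda>(M, N). e \<in> N - M) p) = r"
    using assms(1) unfolding rainbow_cycle_def pre_digraph.cycle_def by auto
  have cas: "pre_digraph.cas ?G u p u" and arcs: "set p \<subseteq> arcs ?G"
    using u(1) unfolding pre_digraph.awalk_def by auto
  have arc: "fst a \<in> noncrossing_matchings n \<and> snd a \<in> noncrossing_matchings n \<and> flip (fst a) (snd a)"
    if "a \<in> set p" for a using arcs that by (auto simp: flip_graph_def)
  have "closes (enc n u) (map ?enc p) (enc n v)" if "pre_digraph.cas ?G u p v" for u v p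
    using that by (induction p arbitrary: u) (auto simp: pre_digraph.cas.simps)
  then have closes: "closes (enc n u) (map ?enc p) (enc n u)" using cas .
  \<comment> \<open>Without its first vertex, the vertex list of a nonempty walk is the list of
    heads of its arcs.\<close>
  have "distinct (map snd p)"
    using u(2,3) pre_digraph.awalk_verts_conv'[OF cas] by simp
  moreover have "inj_on (enc n) (set (map snd p))"
    using inj_on_enc by (rule inj_on_subset) (use arc in auto)
  ultimately have "distinct (map (enc n) (map snd p))" using distinct_map by blast
  then have dist: "distinct (map snd (map ?enc p))" by (simp add: comp_def)
  have rain: "length (filter (\<lambda>a. e \<in> snd a - fst a) (map ?enc p)) = r" if e: "e \<in> odd_pairs n" for e
  proof -
    obtain i j where ij: "e = (i, j)" "i < j" "j < 2 * n" "odd (j - i)" using e by (auto simp: odd_pairs_def)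
    have "length (filter (\<lambda>a. e \<in> snd a - fst a) (map ?enc p)) = length (filter (\<lambda>(M, N). {pt n i, pt n j} \<in> N - M) p)"
      using ij by (simp add: filter_map comp_def enc_def case_prod_unfold)
    then show ?thesis using r[OF odd_pair_possible[OF ij(2-4)]] by simp
  qed
  have "exchange_cycle n r (enc n u) (map ?enc p)"
    using assms(2) closes dist rain arc enc_ncm flip_exchange by unfold_locales auto
  then show ?thesis by blast
qed

theorem theorem22:
  shows "(\<forall>n r :: nat. odd n \<and> n \<ge> 3 \<and> r \<ge> 1 \<longrightarrow> \<not> (\<exists>p. rainbow_cycle n r p)) \<and>
    (\<forall>n r :: nat. even n \<and> n \<ge> 2 \<and> real r > 2 / (real n)\<^sup>2 * gen_narayana 1 n (n div 2) \<longrightarrow>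
       \<not> (\<exists>p. rainbow_cycle n r p))"
proof (intro conjI allI impI notI; elim conjE exE)
  fix n r :: nat and p
  assume "odd n" "n \<ge> 3" "r \<ge> 1" "rainbow_cycle n r p"
  then obtain u ps where "exchange_cycle n r u ps" using rainbow_cycle_exchange_cycle[of n r p] by auto
  then show False using exchange_cycle.even_or_zero \<open>odd n\<close> \<open>r \<ge> 1\<close> by fastforce
next
  fix n r :: nat and p
  assume *: "even n" "n \<ge> 2" "real r > 2 / (real n)\<^sup>2 * gen_narayana 1 n (n div 2)" "rainbow_cycle n r p"
  then obtain u ps where "exchange_cycle n r u ps" using rainbow_cycle_exchange_cycle[of n r p] by auto
  then show False using exchange_cycle.r_bound *(1,3) by (meson not_less)
qed

end
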